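(* The operator $\delta$ is adjoint to $D$: $$E\big[\langle DF,u\rangle_{\ell^2(\mathbb{N})}\big]=E[F\,\delta(u)],\qquad F\in\mathcal{S},\ u\in\mathcal{U}.$$
   Context: $\mathbb{N}=\{0,1,2,\ldots\}$. Let $(p_k)_{k\in\mathbb{N}}$ be a deterministic sequence in $(0,1)$ and $q_k=1-p_k$. Let $\Omega=\{-1,1\}^{\mathbb{N}}$ with its product $\sigma$-algebra, let $X_k:\Omega\to\{-1,1\}$ be the canonical projections, and let $\mathbb{P}$ be the product probability measure under which the $X_k$ are independent with $\mathbb{P}(X_k=1)=p_k$, $\mathbb{P}(X_k=-1)=q_k$. Set $Y_k=\frac{q_k-p_k+X_k}{2\sqrt{p_kq_k}}$. Let $\ell^2(\mathbb{N})^{\circ n}$ be the space of symmetric functions in $\ell^2(\mathbb{N}^n)$, and $\Delta_n=\{(k_1,\ldots,k_n)\in\mathbb{N}^n: k_i\ne k_j,\ 1\le i<j\le n\}$. For $f_n\in\ell^2(\mathbb{N})^{\circ n}$, $n\ge1$, put $J_n(f_n)=\sum_{(i_1,\ldots,i_n)\in\Delta_n}f_n(i_1,\ldots,i_n)Y_{i_1}\cdots Y_{i_n}$ (convergence in $L^2(\Omega)$), and $J_0(f_0)=f_0$ for $f_0\in\mathbb{R}$. $\mathcal{S}$ is the linear space of finite sums $\sum_{k=0}^nJ_k(f_k)$, $f_k\in\ell^2(\mathbb{N})^{\circ k}$, $n\in\mathbb{N}$. The gradient $D:\mathcal{S}\to L^2(\Omega\times\mathbb{N})$ is the linear operator defined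 by $D_kJ_n(f_n)=nJ_{n-1}(f_n( *,k)\mathbf{1}_{\Delta_n}( *,k))$, $k\in\mathbb{N}$, where $*$ stands for the first $n-1$ variables. $\mathcal{U}\subset L^2(\Omega\times\mathbb{N})$ is the space of processes of the form $u_k=\sum_{j=0}^nJ_j(f_{j+1}( *,k))$, $k\in\mathbb{N}$, with $f_{j+1}\in\ell^2(\mathbb{N})^{\circ j}\otimes\ell^2(\mathbb{N})$ (square-summable functions of $j+1$ variables, symmetric in the first $j$ variables), $n\in\mathbb{N}$. The divergence $\delta:\mathcal{U}\to L^2(\Omega)$ is the linear map with $\delta(u)=J_{n+1}(\tilde f_{n+1})$ when $u_k=J_n(f_{n+1}( *,k))$, where $\tilde f_{n+1}(k_1,\ldots,k_{n+1})=\frac1{n+1}\sum_{i=1}^{n+1}f_{n+1}(k_1,\ldots,k_{i-1},k_{i+1},\ldots,k_{n+1},k_i)$ is the symmetrization of $f_{n+1}$. *)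

theory Defs
  imports "HOL-Probability.Probability" "HOL-Combinatorics.Permutations"
begin

text \<open>The sequence space \<open>{-1,1}\<^bsup>\<nat>\<^esup>\<close> with the product of the laws giving mass \<open>p k\<close> to \<open>1\<close>
  and \<open>1 - p k\<close> to \<open>-1\<close>. The canonical projection \<open>X k\<close> is evaluation at \<open>k\<close>.\<close>

definition coin :: "real \<Rightarrow> real measure" where
  "coin r = point_measure {-1, 1} (\<lambda>x. ennreal (if x = 1 then r else 1 - r))"

definition Omega :: "(nat \<Rightarrow> real) \<Rightarrow> (nat \<Rightarrow> real) measure" where
  "Omega p = Pi\<^sub>M UNIV (\<lambda>k. coin (p k))"

definition X :: "nat \<Rightarrow> (nat \<Rightarrow> real) \<Rightarrow> real" where
  "X k \<omega> = \<omega> k"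

definition Y :: "(nat \<Rightarrow> real) \<Rightarrow> nat \<Rightarrow> (nat \<Rightarrow> real) \<Rightarrow> real" where
  "Y p k \<omega> = ((1 - p k) - p k + X k \<omega>) / (2 * sqrt (p k * (1 - p k)))"

text \<open>Elements of \<open>L\<^sup>2\<close> are represented by functions; identities between them are almost sure.\<close>

definition L2 :: "'a measure \<Rightarrow> ('a \<Rightarrow> real) set" where
  "L2 M = {F \<in> borel_measurable M. integrable M (\<lambda>x. (F x)\<^sup>2)}"

text \<open>Points of \<open>\<nat>\<^bsup>n\<^esup>\<close> are lists of length \<open>n\<close>. A function of \<open>n\<close> variables is a function on
  lists whose values at lists of other lengths are never used.\<close>

definition tuples :: "nat \<Rightarrow> nat list set" where
  "tuples n = {ks. length ks = n}"

definition Delta :: "nat \<Rightarrow> nat list set" where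
  "Delta n = {ks \<in> tuples n. distinct ks}"

definition l2 :: "nat \<Rightarrow> (nat list \<Rightarrow> real) set" where
  "l2 n = {f. (\<lambda>ks. (f ks)\<^sup>2) summable_on tuples n}"

definition symmetric_fun :: "nat \<Rightarrow> (nat list \<Rightarrow> real) \<Rightarrow> bool" where
  "symmetric_fun n f \<longleftrightarrow>
     (\<forall>ks\<in>tuples n. \<forall>\<pi>. \<pi> permutes {..<n} \<longrightarrow> f (permute_list \<pi> ks) = f ks)"

definition l2_sym :: "nat \<Rightarrow> (nat list \<Rightarrow> real) set" where
  "l2_sym n = {f \<in> l2 n. symmetric_fun n f}"

definition slice :: "(nat list \<Rightarrow> real) \<Rightarrow> nat \<Rightarrow> nat list \<Rightarrow> real" where
  "slice f k = (\<lambda>ks. f (ks @ [k]))"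

text \<open>The space \<open>l2_sym n \<otimes> l2 1\<close>.\<close>

definition l2_sym_tensor :: "nat \<Rightarrow> (nat list \<Rightarrow> real) set" where
  "l2_sym_tensor n = {f \<in> l2 (Suc n). \<forall>k. symmetric_fun n (slice f k)}"

text \<open>The multiple stochastic integral, as a representative of the \<open>L\<^sup>2\<close> limit of the finite
  partial sums (unconditional summation).\<close>

definition J :: "(nat \<Rightarrow> real) \<Rightarrow> nat \<Rightarrow> (nat list \<Rightarrow> real) \<Rightarrow> (nat \<Rightarrow> real) \<Rightarrow> real" where
  "J p n f =
     (if n = 0 then (\<lambda>\<omega>. f [])
      else (SOME F. F \<in> L2 (Omega p) \<and>
        ((\<lambda>A. \<integral>\<omega>. (F \<omega> - (\<Sum>ks\<in>A. f ks * (\<Prod>i<n. Y p (ks ! i) \<omega>)))\<^sup>2 \<partial>Omega p)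
           \<longlongrightarrow> 0) (finite_subsets_at_top (Delta n))))"

definition chaos_expansion ::
  "(nat \<Rightarrow> real) \<Rightarrow> ((nat \<Rightarrow> real) \<Rightarrow> real) \<Rightarrow> nat \<Rightarrow> (nat \<Rightarrow> nat list \<Rightarrow> real) \<Rightarrow> bool" where
  "chaos_expansion p F n f \<longleftrightarrow>
     F \<in> L2 (Omega p) \<and> (\<forall>j\<le>n. f j \<in> l2_sym j) \<and>
     (AE \<omega> in Omega p. F \<omega> = (\<Sum>j\<le>n. J p j (f j) \<omega>))"

definition S_space :: "(nat \<Rightarrow> real) \<Rightarrow> ((nat \<Rightarrow> real) \<Rightarrow> real) set" where
  "S_space p = {F. \<exists>n f. chaos_expansion p F n f}"

text \<open>The linear extension of \<open>D\<^sub>k (J\<^sub>n f) = n J\<^sub>n\<^sub>-\<^sub>1 (f(*,k) 1\<^bsub>\<Delta>\<^sub>n\<^esub>(*,k))\<close>. The choice of expansion does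
  not matter up to null sets: integrals of different orders are orthogonal and
  \<open>E[(J\<^sub>n f)\<^sup>2]\<close> is \<open>n!\<close> times the squared norm of \<open>f 1\<^bsub>\<Delta>\<^sub>n\<^esub>\<close>, so \<open>F\<close> determines each kernel on \<open>\<Delta>\<^sub>n\<close>.
  The term \<open>j = 0\<close> vanishes. The same remark applies to the divergence below.\<close>

definition gradient ::
  "(nat \<Rightarrow> real) \<Rightarrow> ((nat \<Rightarrow> real) \<Rightarrow> real) \<Rightarrow> nat \<Rightarrow> (nat \<Rightarrow> real) \<Rightarrow> real" where
  "gradient p F = (SOME G. \<exists>n f. chaos_expansion p F n f \<and>
     G = (\<lambda>k \<omega>. \<Sum>j=1..n. real j *
            J p (j - 1) (slice (\<lambda>ks. f j ks * indicator (Delta j) ks) k) \<omega>))"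

definition process_expansion ::
  "(nat \<Rightarrow> real) \<Rightarrow> (nat \<Rightarrow> (nat \<Rightarrow> real) \<Rightarrow> real) \<Rightarrow> nat \<Rightarrow> (nat \<Rightarrow> nat list \<Rightarrow> real) \<Rightarrow> bool" where
  "process_expansion p u n f \<longleftrightarrow>
     (\<lambda>(\<omega>, k). u k \<omega>) \<in> L2 (Omega p \<Otimes>\<^sub>M count_space UNIV) \<and>
     (\<forall>j\<le>n. f (Suc j) \<in> l2_sym_tensor j) \<and>
     (\<forall>k. AE \<omega> in Omega p. u k \<omega> = (\<Sum>j\<le>n. J p j (slice (f (Suc j)) k) \<omega>))"

definition U_space :: "(nat \<Rightarrow> real) \<Rightarrow> (nat \<Rightarrow> (nat \<Rightarrow> real) \<Rightarrow> real) set" where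
  "U_space p = {u. \<exists>n f. process_expansion p u n f}"

text \<open>Symmetrization of a function of \<open>n\<close> variables: average over moving one variable to the
  last place.\<close>

definition symmetrize :: "nat \<Rightarrow> (nat list \<Rightarrow> real) \<Rightarrow> nat list \<Rightarrow> real" where
  "symmetrize n f ks = (1 / real n) * (\<Sum>i<n. f (take i ks @ drop (Suc i) ks @ [ks ! i]))"

definition divergence ::
  "(nat \<Rightarrow> real) \<Rightarrow> (nat \<Rightarrow> (nat \<Rightarrow> real) \<Rightarrow> real) \<Rightarrow> (nat \<Rightarrow> real) \<Rightarrow> real" where
  "divergence p u = (SOME G. \<exists>n f. process_expansion p u n f \<and>
     G = (\<lambda>\<omega>. \<Sum>j\<le>n. J p (Suc j) (symmetrize (Suc j) (f (Suc j))) \<omega>))"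

end

theory Submission
  imports Defs "HOL-Combinatorics.Multiset_Permutations"
begin

text \<open>The products \<open>Y\<^sub>S = \<Prod>k\<in>S. Y\<^sub>k\<close> over finite sets \<open>S\<close> are orthonormal, because the \<open>Y\<^sub>k\<close> are
  independent with mean 0 and variance 1. As \<open>n!\<close> tuples have the same set of entries, the partial
  sums defining \<open>J\<^sub>n f\<close> satisfy a Bessel inequality with constant \<open>n!\<close>, hence converge in \<open>L\<^sup>2\<close>, and
  \<open>E[J\<^sub>n f G]\<close> is the sum of \<open>f(ks) c\<^sub>G(ks)\<close> over \<open>ks \<in> \<Delta>\<^sub>n\<close>, where \<open>c\<^sub>G(ks) = E[Y\<^bsub>set ks\<^esub> G]\<close>. For
  \<open>F = \<Sum>\<^sub>j J\<^sub>j f\<^sub>j\<close> with symmetric kernels \<open>c\<^sub>F\<close> is \<open>n! f\<^sub>n\<close> on \<open>\<Delta>\<^sub>n\<close>, and the coefficient of \<open>D\<^sub>k F\<close> at \<open>ks\<close>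
  is \<open>c\<^sub>F(ks, k)\<close> when \<open>(ks, k)\<close> has distinct entries and 0 otherwise. So both sides of the duality
  equal \<open>\<Sum>\<^sub>j \<Sum>\<^bsub>ks\<in>\<Delta>\<^sub>j\<^sub>+\<^sub>1\<^esub> g\<^sub>j\<^sub>+\<^sub>1(ks) c\<^sub>F(ks)\<close> for any kernels \<open>g\<close> of \<open>u\<close>: symmetrizing \<open>g\<^sub>j\<^sub>+\<^sub>1\<close> does not change
  the sum, since \<open>c\<^sub>F\<close> depends only on the set of entries.\<close>

subsection \<open>Square-integrable functions\<close>

lemma abs_mult_le_sum_squares: "\<bar>a * b\<bar> \<le> a\<^sup>2 + b\<^sup>2" for a b :: real
proof -
  have "2 * \<bar>a * b\<bar> \<le> a\<^sup>2 + b\<^sup>2"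
    using sum_squares_bound[of "\<bar>a\<bar>" "\<bar>b\<bar>"] by (simp add: abs_mult mult.assoc)
  then show ?thesis using abs_ge_zero[of "a * b"] by linarith
qed

lemma L2_borel_measurable: "f \<in> L2 M \<Longrightarrow> f \<in> borel_measurable M"
  by (simp add: L2_def)

lemma L2_integrable_square: "f \<in> L2 M \<Longrightarrow> integrable M (\<lambda>x. (f x)\<^sup>2)"
  by (simp add: L2_def)

lemma L2_mult_integrable:
  assumes "f \<in> L2 M" "g \<in> L2 M"
  shows "integrable M (\<lambda>x. f x * g x)"
proof (rule Bochner_Integration.integrable_bound)
  show "integrable M (\<lambda>x. (f x)\<^sup>2 + (g x)\<^sup>2)"
    using assms by (simp add: L2_def)
  show "(\<lambda>x. f x * g x) \<in> borel_measurable M"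
    using assms by (auto simp: L2_def)
  show "AE x in M. norm (f x * g x) \<le> norm ((f x)\<^sup>2 + (g x)\<^sup>2)"
    by (simp add: abs_mult_le_sum_squares)
qed

lemma L2_zero: "(\<lambda>x. 0) \<in> L2 M"
  by (simp add: L2_def)

lemma L2_cmult: "f \<in> L2 M \<Longrightarrow> (\<lambda>x. c * f x) \<in> L2 M"
  by (auto simp: L2_def power_mult_distrib)

lemma L2_add:
  assumes "f \<in> L2 M" "g \<in> L2 M"
  shows "(\<lambda>x. f x + g x) \<in> L2 M"
  using assms L2_mult_integrable[OF assms] by (auto simp: L2_def power2_sum mult.assoc)

lemma L2_diff:
  assumes "f \<in> L2 M" "g \<in> L2 M"
  shows "(\<lambda>x. f x - g x) \<in> L2 M"
  using L2_add[OF assms(1) L2_cmult[OF assms(2), of "-1"]] by simp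

lemma L2_sum:
  assumes "\<And>i. i \<in> I \<Longrightarrow> f i \<in> L2 M"
  shows "(\<lambda>x. \<Sum>i\<in>I. f i x) \<in> L2 M"
  using assms by (induction I rule: infinite_finite_induct) (auto intro: L2_zero L2_add)

lemma L2_Cauchy_Schwarz:
  assumes f: "f \<in> L2 M" and g: "g \<in> L2 M"
  shows "(\<integral>x. f x * g x \<partial>M)\<^sup>2 \<le> (\<integral>x. (f x)\<^sup>2 \<partial>M) * (\<integral>x. (g x)\<^sup>2 \<partial>M)"
proof -
  let ?a = "\<integral>x. (f x)\<^sup>2 \<partial>M" and ?b = "\<integral>x. (g x)\<^sup>2 \<partial>M" and ?c = "\<integral>x. f x * g x \<partial>M"
  note [simp] = L2_integrable_square[OF f] L2_integrable_square[OF g] L2_mult_integrable[OF f g]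
  have "0 \<le> ?b" by simp
  then consider "?b = 0" | "0 < ?b" by linarith
  then show ?thesis
  proof cases
    case 1
    then have "AE x in M. (g x)\<^sup>2 = 0"
      by (subst (asm) integral_nonneg_eq_0_iff_AE) auto
    then have "?c = (\<integral>x. 0 \<partial>M)"
      using L2_borel_measurable[OF f] L2_borel_measurable[OF g] by (intro integral_cong_AE) auto
    then show ?thesis by simp
  next
    case 2
    \<comment> \<open>This \<open>t\<close> minimizes the quadratic
      \<open>\<integral>(f - t g)\<^sup>2\<close>, whose nonnegativity at the minimum is the
      claim.\<close>
    define t where "t = ?c / ?b"
    have "0 \<le> (\<integral>x. (f x - t * g x)\<^sup>2 \<partial>M)" by simp
    also have "(\<lambda>x. (f x - t * g x)\<^sup>2) = (\<lambda>x. (f x)\<^sup>2 - 2 * t * (f x * g x) + t\<^sup>2 * (g x)\<^sup>2)"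
      by (auto simp: power2_eq_square algebra_simps)
    also have "(\<integral>x. \<dots> x \<partial>M) = ?a - 2 * t * ?c + t\<^sup>2 * ?b"
      by simp
    also have "\<dots> = ?a - ?c\<^sup>2 / ?b"
      using 2 by (simp add: t_def power2_eq_square field_simps)
    finally show ?thesis using 2 by (simp add: field_simps)
  qed
qed

lemma L2_abs_inner_le:
  assumes "f \<in> L2 M" "g \<in> L2 M"
  shows "\<bar>\<integral>x. f x * g x \<partial>M\<bar> \<le> sqrt (\<integral>x. (f x)\<^sup>2 \<partial>M) * sqrt (\<integral>x. (g x)\<^sup>2 \<partial>M)"
  using real_sqrt_le_mono[OF L2_Cauchy_Schwarz[OF assms]] by (simp add: real_sqrt_mult)

section \<open>Completeness and unconditionally convergent series in L2\<close>

lemma AE_summable_of_summable_integral: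
  fixes f :: "nat \<Rightarrow> 'a \<Rightarrow> real"
  assumes f: "\<And>i. integrable M (f i)" and s: "summable (\<lambda>i. \<integral>x. \<bar>f i x\<bar> \<partial>M)"
  shows "AE x in M. summable (\<lambda>i. \<bar>f i x\<bar>)"
proof -
  note [measurable] = borel_measurable_integrable[OF f]
  have "(\<integral>\<^sup>+x. (\<Sum>i. ennreal \<bar>f i x\<bar>) \<partial>M) = (\<Sum>i. \<integral>\<^sup>+x. ennreal \<bar>f i x\<bar> \<partial>M)"
    by (intro nn_integral_suminf) auto
  also have "\<dots> = (\<Sum>i. ennreal (\<integral>x. \<bar>f i x\<bar> \<partial>M))"
    using f by (subst nn_integral_eq_integral) auto
  finally have "(\<integral>\<^sup>+x. (\<Sum>i. ennreal \<bar>f i x\<bar>) \<partial>M) \<noteq> \<infinity>"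
    by (simp add: ennreal_suminf_neq_top[OF s])
  then have "AE x in M. (\<Sum>i. ennreal \<bar>f i x\<bar>) \<noteq> \<infinity>"
    by (intro nn_integral_noteq_infinite) measurable
  then show ?thesis
    by eventually_elim (rule summable_suminf_not_top, simp_all)
qed

text \<open>Riesz-Fischer for a sequence that is already geometrically fast: the increments have
  summable L1 norms, so the sequence converges almost surely, and Fatou carries the quantitative
  bound over to the limit.\<close>

lemma L2_complete:
  assumes M: "prob_space M" and S: "\<And>m. S m \<in> L2 M"
    and Cauchy: "\<And>m k. m \<le> k \<Longrightarrow> (\<integral>x. (S k x - S m x)\<^sup>2 \<partial>M) \<le> (1/4)^m"
  obtains F where "F \<in> L2 M" "\<And>m. (\<integral>x. (F x - S m x)\<^sup>2 \<partial>M) \<le> (1/4)^m"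
proof -
  interpret prob_space M by fact
  note [measurable] = L2_borel_measurable[OF S]
  have one: "(\<lambda>x. 1) \<in> L2 M" by (simp add: L2_def)
  define d where "d m x = S (Suc m) x - S m x" for m x
  have d: "d m \<in> L2 M" for m
    unfolding d_def by (intro L2_diff S)
  have abs_d: "(\<lambda>x. \<bar>d m x\<bar>) \<in> L2 M" for m
    using d[of m] by (auto simp: L2_def)
  have le: "(\<integral>x. \<bar>d m x\<bar> \<partial>M) \<le> (1/2)^m" for m
  proof (rule power2_le_imp_le)
    \<comment> \<open>Cauchy-Schwarz against the constant 1, which has norm 1 in a probability
      space.\<close>
    have "(\<integral>x. \<bar>d m x\<bar> \<partial>M)\<^sup>2 \<le> (\<integral>x. (d m x)\<^sup>2 \<partial>M)"
      using L2_Cauchy_Schwarz[OF abs_d[of m] one] by (simp add: prob_space)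
    also have "\<dots> \<le> (1/4)^m"
      unfolding d_def by (rule Cauchy) simp
    also have "\<dots> = ((1/2)^m)\<^sup>2"
      by (simp add: power2_eq_square flip: power_mult_distrib)
    finally show "(\<integral>x. \<bar>d m x\<bar> \<partial>M)\<^sup>2 \<le> ((1/2)^m)\<^sup>2" .
  qed simp
  have "AE x in M. summable (\<lambda>m. \<bar>d m x\<bar>)"
  proof (rule AE_summable_of_summable_integral)
    show "integrable M (d m)" for m
      using L2_mult_integrable[OF d one] by simp
    show "summable (\<lambda>m. \<integral>x. \<bar>d m x\<bar> \<partial>M)"
      by (rule summable_comparison_test'[OF summable_geometric[of "1/2::real"]]) (use le in auto)
  qed
  then have lim: "AE x in M. (\<lambda>k. S k x) \<longlonglongrightarrow> lim (\<lambda>k. S k x)"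
  proof eventually_elim
    case (elim x)
    have eq: "S k x = S 0 x + (\<Sum>m<k. d m x)" for k
      by (induction k) (auto simp: d_def)
    have "convergent (\<lambda>k. \<Sum>m<k. d m x)"
      using summable_rabs_cancel[OF elim] by (simp add: summable_iff_convergent)
    then have "convergent (\<lambda>k. S 0 x + (\<Sum>m<k. d m x))"
      by (intro convergent_add convergent_const)
    moreover have "(\<lambda>k. S 0 x + (\<Sum>m<k. d m x)) = (\<lambda>k. S k x)"
      by (rule ext, rule eq[symmetric])
    ultimately have "convergent (\<lambda>k. S k x)" by (rule back_subst)
    then show ?case by (simp add: convergent_LIMSEQ_iff)
  qed
  \<comment> \<open>A pointwise \<open>lim\<close> is measurable on the whole space; its values on
    the null set without convergence do not affect the integrals.\<close>
  define F where "F x = lim (\<lambda>k. S k x)" for x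
  have [measurable]: "F \<in> borel_measurable M"
    unfolding F_def by measurable
  have nn: "(\<integral>\<^sup>+x. ennreal ((F x - S m x)\<^sup>2) \<partial>M) \<le> ennreal ((1/4)^m)" for m
  proof -
    have "(\<integral>\<^sup>+x. ennreal ((F x - S m x)\<^sup>2) \<partial>M) =
        (\<integral>\<^sup>+x. liminf (\<lambda>k. ennreal ((S k x - S m x)\<^sup>2)) \<partial>M)"
    proof (rule nn_integral_cong_AE)
      show "AE x in M. ennreal ((F x - S m x)\<^sup>2) = liminf (\<lambda>k. ennreal ((S k x - S m x)\<^sup>2))"
        using lim
      proof eventually_elim
        case (elim x)
        then have "(\<lambda>k. ennreal ((S k x - S m x)\<^sup>2)) \<longlonglongrightarrow> ennreal ((F x - S m x)\<^sup>2)"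
          unfolding F_def by (intro tendsto_intros tendsto_ennrealI)
        then show ?case by (rule lim_imp_Liminf[OF sequentially_bot, symmetric])
      qed
    qed
    also have "\<dots> \<le> liminf (\<lambda>k. \<integral>\<^sup>+x. ennreal ((S k x - S m x)\<^sup>2) \<partial>M)"
      by (intro nn_integral_liminf) measurable
    also have "\<dots> \<le> liminf (\<lambda>k. ennreal ((1/4)^m))"
    proof (rule Liminf_mono)
      show "\<forall>\<^sub>F k in sequentially. (\<integral>\<^sup>+x. ennreal ((S k x - S m x)\<^sup>2) \<partial>M) \<le> ennreal ((1/4)^m)"
        using eventually_ge_at_top[of m]
      proof eventually_elim
        case (elim k)
        have "(\<integral>\<^sup>+x. ennreal ((S k x - S m x)\<^sup>2) \<partial>M) = ennreal (\<integral>x. (S k x - S m x)\<^sup>2 \<partial>M)"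
          by (intro nn_integral_eq_integral L2_integrable_square L2_diff S) simp
        then show ?case using Cauchy[OF elim] by (simp add: ennreal_leI)
      qed
    qed
    finally show ?thesis by (simp add: Liminf_const)
  qed
  have "(\<lambda>x. F x - S 0 x) \<in> L2 M"
    using nn[of 0] by (auto simp: L2_def integrable_iff_bounded le_less_trans)
  from L2_add[OF this S[of 0]] have "F \<in> L2 M" by simp
  moreover have "(\<integral>x. (F x - S m x)\<^sup>2 \<partial>M) \<le> (1/4)^m" for m
    by (rule integral_real_bounded) (use nn in auto)
  ultimately show ?thesis by (rule that)
qed

text \<open>The net of finite partial sums need not have a countable base, so the limit is taken along a
  sequence of finite sets that exhaust the square sum geometrically fast.\<close>

lemma L2_unconditional_sum:
  fixes e :: "'i \<Rightarrow> 'a \<Rightarrow> real"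
  assumes M: "prob_space M" and e: "\<And>i. i \<in> I \<Longrightarrow> e i \<in> L2 M"
    and f: "(\<lambda>i. (f i)\<^sup>2) summable_on I" and C: "0 < C"
    and Bessel: "\<And>A. finite A \<Longrightarrow> A \<subseteq> I \<Longrightarrow>
      (\<integral>x. (\<Sum>i\<in>A. f i * e i x)\<^sup>2 \<partial>M) \<le> C * (\<Sum>i\<in>A. (f i)\<^sup>2)"
  obtains F where "F \<in> L2 M"
    "((\<lambda>A. \<integral>x. (F x - (\<Sum>i\<in>A. f i * e i x))\<^sup>2 \<partial>M) \<longlongrightarrow> 0) (finite_subsets_at_top I)"
proof -
  let ?s = "\<lambda>A x. \<Sum>i\<in>A. f i * e i x"
  have L2: "?s A \<in> L2 M" if "A \<subseteq> I" for A
    using that e by (auto intro!: L2_sum L2_cmult)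
  obtain T where T: "((\<lambda>i. (f i)\<^sup>2) has_sum T) I"
    using f by (auto simp: summable_on_def)
  \<comment> \<open>Take \<open>A\<close> whose square sum is within \<open>(1/4)^m / C\<close> of
    the total; any finite set disjoint from it then carries at most that much. The division by
    \<open>C\<close> cancels the Bessel constant.\<close>
  have "\<exists>A. finite A \<and> A \<subseteq> I \<and> (\<forall>B. finite B \<longrightarrow> B \<subseteq> I - A \<longrightarrow> (\<Sum>i\<in>B. (f i)\<^sup>2) \<le> (1/4)^m / C)" for m :: nat
  proof -
    have "\<forall>\<^sub>F A in finite_subsets_at_top I. T - (1/4)^m / C < (\<Sum>i\<in>A. (f i)\<^sup>2)"
      using T C by (intro order_tendstoD(1)[where y = T]) (auto simp: has_sum_def)
    then obtain A where A: "finite A" "A \<subseteq> I"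
      "\<And>B. finite B \<Longrightarrow> A \<subseteq> B \<Longrightarrow> B \<subseteq> I \<Longrightarrow> T - (1/4)^m / C < (\<Sum>i\<in>B. (f i)\<^sup>2)"
      by (auto simp: eventually_finite_subsets_at_top)
    have "(\<Sum>i\<in>B. (f i)\<^sup>2) \<le> (1/4)^m / C" if B: "finite B" "B \<subseteq> I - A" for B
    proof -
      have "(\<Sum>i\<in>A. (f i)\<^sup>2) + (\<Sum>i\<in>B. (f i)\<^sup>2) = (\<Sum>i\<in>A \<union> B. (f i)\<^sup>2)"
        using A B by (subst sum.union_disjoint) auto
      also have "\<dots> \<le> T"
        using A B by (intro has_sum_mono_neutral[OF has_sum_finite T]) auto
      finally show ?thesis using A(3)[OF A(1) subset_refl A(2)] by linarith
    qed
    with A show ?thesis by blast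
  qed
  then obtain A0 where A0: "\<And>m. finite (A0 m)" "\<And>m. A0 m \<subseteq> I"
    "\<And>m B. finite B \<Longrightarrow> B \<subseteq> I - A0 m \<Longrightarrow> (\<Sum>i\<in>B. (f i)\<^sup>2) \<le> (1/4)^m / C"
    by metis
  \<comment> \<open>Unions make the sets increase with \<open>m\<close>, so that the tail estimate
    becomes the Cauchy bound for \<open>m \<le> k\<close>.\<close>
  define A where "A m = (\<Union>j\<le>m. A0 j)" for m
  have A: "finite (A m)" "A m \<subseteq> I" "A0 m \<subseteq> A m" for m
    using A0 by (auto simp: A_def)
  have tail: "(\<integral>x. (?s B x - ?s (A m) x)\<^sup>2 \<partial>M) \<le> (1/4)^m" if "finite B" "B \<subseteq> I" "A m \<subseteq> B" for m B
  proof -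
    have "(\<lambda>x. ?s B x - ?s (A m) x) = ?s (B - A m)"
      using that by (auto simp: sum_diff fun_eq_iff)
    then have "(\<integral>x. (?s B x - ?s (A m) x)\<^sup>2 \<partial>M) = (\<integral>x. (?s (B - A m) x)\<^sup>2 \<partial>M)"
      by (metis (no_types, lifting))
    also have "\<dots> \<le> C * (\<Sum>i\<in>B - A m. (f i)\<^sup>2)"
      using that by (intro Bessel) auto
    also have "\<dots> \<le> C * ((1/4)^m / C)"
      using that A(3)[of m] C by (intro mult_left_mono A0(3)) auto
    finally show ?thesis using C by simp
  qed
  obtain F where F: "F \<in> L2 M" "\<And>m. (\<integral>x. (F x - ?s (A m) x)\<^sup>2 \<partial>M) \<le> (1/4)^m"
  proof (rule L2_complete[OF M, of "\<lambda>m. ?s (A m)"])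
    show "?s (A m) \<in> L2 M" for m using A by (intro L2)
    show "(\<integral>x. (?s (A k) x - ?s (A m) x)\<^sup>2 \<partial>M) \<le> (1/4)^m" if "m \<le> k" for m k
    proof (rule tail)
      show "A m \<subseteq> A k"
        using that unfolding A_def by (intro UN_mono) auto
    qed (fact A)+
  qed (rule that)
  \<comment> \<open>This passes from the sequence \<open>A m\<close> to the net: \<open>F\<close>
    and the sum over \<open>B\<close> are both compared with the sum over \<open>A m\<close> by (a -
    b)^2 \<le> 2 a^2 + 2 b^2, and 4 = 2 + 2.\<close>
  have est: "(\<integral>x. (F x - ?s B x)\<^sup>2 \<partial>M) \<le> 4 * (1/4)^m" if B: "finite B" "B \<subseteq> I" "A m \<subseteq> B" for m B
  proof -
    have FA: "(\<lambda>x. F x - ?s (A m) x) \<in> L2 M" and BA: "(\<lambda>x. ?s B x - ?s (A m) x) \<in> L2 M"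
      and FB: "(\<lambda>x. F x - ?s B x) \<in> L2 M"
      by (intro L2_diff F(1) L2 A B)+
    have "(\<integral>x. (F x - ?s B x)\<^sup>2 \<partial>M) \<le>
        (\<integral>x. 2 * (F x - ?s (A m) x)\<^sup>2 + 2 * (?s B x - ?s (A m) x)\<^sup>2 \<partial>M)"
    proof (rule integral_mono)
      show "(F x - ?s B x)\<^sup>2 \<le> 2 * (F x - ?s (A m) x)\<^sup>2 + 2 * (?s B x - ?s (A m) x)\<^sup>2" for x
        using zero_le_power2[of "F x - ?s (A m) x + (?s B x - ?s (A m) x)"]
        by (simp add: power2_eq_square algebra_simps)
    qed (intro L2_integrable_square FA BA FB Bochner_Integration.integrable_add integrable_mult_right)+
    also have "\<dots> = 2 * (\<integral>x. (F x - ?s (A m) x)\<^sup>2 \<partial>M) + 2 * (\<integral>x. (?s B x - ?s (A m) x)\<^sup>2 \<partial>M)"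
      using L2_integrable_square[OF FA] L2_integrable_square[OF BA] by simp
    also have "\<dots> \<le> 4 * (1/4)^m"
      using F(2)[of m] tail[OF B] by linarith
    finally show ?thesis .
  qed
  have "((\<lambda>B. \<integral>x. (F x - ?s B x)\<^sup>2 \<partial>M) \<longlongrightarrow> 0) (finite_subsets_at_top I)"
  proof (rule order_tendstoI)
    fix \<epsilon> :: real assume "0 < \<epsilon>"
    then obtain m where m: "(1/4)^m < \<epsilon> / 4"
      using real_arch_pow_inv[of "\<epsilon> / 4" "1/4"] by auto
    show "\<forall>\<^sub>F B in finite_subsets_at_top I. (\<integral>x. (F x - ?s B x)\<^sup>2 \<partial>M) < \<epsilon>"
      unfolding eventually_finite_subsets_at_top
    proof (intro exI[of _ "A m"] conjI allI impI)
      fix B assume "finite B \<and> A m \<subseteq> B \<and> B \<subseteq> I"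
      then show "(\<integral>x. (F x - ?s B x)\<^sup>2 \<partial>M) < \<epsilon>"
        using est[of B m] m by linarith
    qed (use A in auto)
  qed (simp add: always_eventually less_le_trans)
  with F(1) show ?thesis by (rule that)
qed

text \<open>By Cauchy-Schwarz the inner product with \<open>G\<close> is continuous on L2, so
  convergence of the partial sums to \<open>F\<close> in L2 becomes convergence of the numerical
  series.\<close>

lemma L2_inner_has_sum:
  fixes e :: "'i \<Rightarrow> 'a \<Rightarrow> real"
  assumes e: "\<And>i. i \<in> I \<Longrightarrow> e i \<in> L2 M" and F: "F \<in> L2 M"
    and lim: "((\<lambda>A. \<integral>x. (F x - (\<Sum>i\<in>A. f i * e i x))\<^sup>2 \<partial>M) \<longlongrightarrow> 0) (finite_subsets_at_top I)"
    and G: "G \<in> L2 M"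
  shows "((\<lambda>i. f i * (\<integral>x. e i x * G x \<partial>M)) has_sum (\<integral>x. F x * G x \<partial>M)) I"
proof -
  let ?s = "\<lambda>A x. \<Sum>i\<in>A. f i * e i x"
  have L2: "?s A \<in> L2 M" if "A \<subseteq> I" for A
    using that e by (auto intro!: L2_sum L2_cmult)
  have inner: "(\<Sum>i\<in>A. f i * (\<integral>x. e i x * G x \<partial>M)) = (\<integral>x. ?s A x * G x \<partial>M)" if "A \<subseteq> I" for A
  proof -
    have "(\<integral>x. ?s A x * G x \<partial>M) = (\<integral>x. (\<Sum>i\<in>A. f i * (e i x * G x)) \<partial>M)"
      by (simp add: sum_distrib_right mult.assoc)
    also have "\<dots> = (\<Sum>i\<in>A. \<integral>x. f i * (e i x * G x) \<partial>M)"
      using that e G by (intro Bochner_Integration.integral_sum) (auto intro!: L2_mult_integrable)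
    finally show ?thesis by simp
  qed
  have bound: "\<forall>\<^sub>F A in finite_subsets_at_top I.
      norm ((\<Sum>i\<in>A. f i * (\<integral>x. e i x * G x \<partial>M)) - (\<integral>x. F x * G x \<partial>M))
        \<le> sqrt (\<integral>x. (F x - ?s A x)\<^sup>2 \<partial>M) * sqrt (\<integral>x. (G x)\<^sup>2 \<partial>M)"
  proof (rule eventually_finite_subsets_at_top_weakI)
    fix A assume A: "finite A" "A \<subseteq> I"
    have "(\<integral>x. F x * G x \<partial>M) - (\<integral>x. ?s A x * G x \<partial>M) = (\<integral>x. (F x - ?s A x) * G x \<partial>M)"
      by (subst Bochner_Integration.integral_diff[symmetric])
         (intro L2_mult_integrable F G L2 A, intro L2_mult_integrable F G L2 A,
          simp only: left_diff_distrib)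
    with L2_abs_inner_le[OF L2_diff[OF F L2[OF A(2)]] G]
    show "norm ((\<Sum>i\<in>A. f i * (\<integral>x. e i x * G x \<partial>M)) - (\<integral>x. F x * G x \<partial>M))
        \<le> sqrt (\<integral>x. (F x - ?s A x)\<^sup>2 \<partial>M) * sqrt (\<integral>x. (G x)\<^sup>2 \<partial>M)"
      by (simp add: inner[OF A(2)] abs_minus_commute)
  qed
  have "((\<lambda>A. sqrt (\<integral>x. (F x - ?s A x)\<^sup>2 \<partial>M) * sqrt (\<integral>x. (G x)\<^sup>2 \<partial>M)) \<longlongrightarrow>
      sqrt 0 * sqrt (\<integral>x. (G x)\<^sup>2 \<partial>M)) (finite_subsets_at_top I)"
    by (intro tendsto_intros lim)
  then have "((\<lambda>A. sqrt (\<integral>x. (F x - ?s A x)\<^sup>2 \<partial>M) * sqrt (\<integral>x. (G x)\<^sup>2 \<partial>M)) \<longlongrightarrow> 0)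
      (finite_subsets_at_top I)"
    by (simp only: real_sqrt_zero mult_zero_left)
  then show ?thesis
    unfolding has_sum_def by (rule LIM_zero_cancel[OF Lim_null_comparison[OF bound]])
qed

section \<open>Exchanging the sum over k with the expectation\<close>

lemma infsum_eq_suminf_real:
  fixes f :: "nat \<Rightarrow> real"
  assumes "summable (\<lambda>n. \<bar>f n\<bar>)"
  shows "(\<Sum>\<^sub>\<infinity>n. f n) = (\<Sum>n. f n)"
proof (rule infsumI, rule norm_summable_imp_has_sum)
  show "summable (\<lambda>n. norm (f n))" using assms by simp
  show "f sums (\<Sum>n. f n)" by (rule summable_sums, rule summable_rabs_cancel, rule assms)
qed

lemma borel_measurable_infsum_nat:
  fixes f :: "nat \<Rightarrow> 'a \<Rightarrow> real"
  assumes [measurable]: "\<And>k. f k \<in> borel_measurable M"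
  shows "(\<lambda>x. \<Sum>\<^sub>\<infinity>k. f k x) \<in> borel_measurable M"
proof -
  \<comment> \<open>The unconditional sum defaults to 0 wherever absolute convergence fails, also
    where the ordered series converges. The sum in \<open>ennreal\<close> detects these points
    measurably.\<close>
  have "(\<Sum>\<^sub>\<infinity>k. f k x) = (if (\<Sum>k. ennreal \<bar>f k x\<bar>) = top then 0 else (\<Sum>k. f k x))" for x
  proof (cases "summable (\<lambda>k. \<bar>f k x\<bar>)")
    case True
    then show ?thesis
      by (simp add: ennreal_suminf_neq_top infsum_eq_suminf_real)
  next
    case False
    then have "\<not> (\<lambda>k. f k x) summable_on UNIV"
      by (subst summable_on_iff_abs_summable_on_real) (simp add: summable_on_UNIV_nonneg_real_iff)
    moreover have "(\<Sum>k. ennreal \<bar>f k x\<bar>) = top"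
      by (rule ccontr) (use False in \<open>simp add: summable_suminf_not_top\<close>)
    ultimately show ?thesis by (simp add: infsum_not_exists)
  qed
  then show ?thesis by simp
qed

text \<open>Since |a b| \<le> a^2 + b^2, the L1 norms of the products are summable. The series then
  converges absolutely almost surely and may be integrated term by term.\<close>

lemma integral_infsum_inner:
  fixes a b :: "nat \<Rightarrow> 'a \<Rightarrow> real"
  assumes a: "\<And>k. a k \<in> L2 M" and b: "\<And>k. b k \<in> L2 M"
    and sa: "summable (\<lambda>k. \<integral>x. (a k x)\<^sup>2 \<partial>M)" and sb: "summable (\<lambda>k. \<integral>x. (b k x)\<^sup>2 \<partial>M)"
  shows "(\<integral>x. (\<Sum>\<^sub>\<infinity>k. a k x * b k x) \<partial>M) = (\<Sum>\<^sub>\<infinity>k. \<integral>x. a k x * b k x \<partial>M)"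
proof -
  note [measurable] = L2_borel_measurable[OF a] L2_borel_measurable[OF b]
  have int: "integrable M (\<lambda>x. a k x * b k x)" for k
    by (intro L2_mult_integrable a b)
  have le: "(\<integral>x. \<bar>a k x * b k x\<bar> \<partial>M) \<le> (\<integral>x. (a k x)\<^sup>2 \<partial>M) + (\<integral>x. (b k x)\<^sup>2 \<partial>M)" for k
  proof -
    have "(\<integral>x. \<bar>a k x * b k x\<bar> \<partial>M) \<le> (\<integral>x. (a k x)\<^sup>2 + (b k x)\<^sup>2 \<partial>M)"
      by (intro integral_mono integrable_abs int Bochner_Integration.integrable_add
          L2_integrable_square a b abs_mult_le_sum_squares)
    then show ?thesis
      using L2_integrable_square[OF a[of k]] L2_integrable_square[OF b[of k]] by simp
  qed
  have sum: "summable (\<lambda>k. \<integral>x. \<bar>a k x * b k x\<bar> \<partial>M)"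
    by (rule summable_comparison_test'[OF summable_add[OF sa sb]]) (use le in auto)
  note AE = AE_summable_of_summable_integral[OF int sum]
  have "(\<integral>x. (\<Sum>\<^sub>\<infinity>k. a k x * b k x) \<partial>M) = (\<integral>x. (\<Sum>k. a k x * b k x) \<partial>M)"
  proof (rule integral_cong_AE)
    show "AE x in M. (\<Sum>\<^sub>\<infinity>k. a k x * b k x) = (\<Sum>k. a k x * b k x)"
      using AE by eventually_elim (rule infsum_eq_suminf_real)
  qed (intro borel_measurable_infsum_nat borel_measurable_times borel_measurable_suminf
      L2_borel_measurable a b)+
  also have "\<dots> = (\<Sum>k. \<integral>x. a k x * b k x \<partial>M)"
    by (rule integral_suminf) (use int AE sum in auto)
  also have "\<dots> = (\<Sum>\<^sub>\<infinity>k. \<integral>x. a k x * b k x \<partial>M)"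
    by (rule infsum_eq_suminf_real[symmetric])
       (rule summable_comparison_test'[OF sum], use integral_abs_bound in auto)
  finally show ?thesis .
qed

text \<open>Fubini with counting measure in the second factor: there, almost every \<open>k\<close>
  means every \<open>k\<close>, and integrability over \<open>k\<close> means summability.\<close>

lemma L2_pair_count_space:
  fixes u :: "nat \<Rightarrow> 'a \<Rightarrow> real"
  assumes M: "prob_space M" and u: "(\<lambda>(x, k). u k x) \<in> L2 (M \<Otimes>\<^sub>M count_space UNIV)"
  shows "\<And>k. u k \<in> L2 M" "summable (\<lambda>k. \<integral>x. (u k x)\<^sup>2 \<partial>M)"
proof -
  interpret prob_space M by fact
  interpret P: pair_sigma_finite M "count_space UNIV :: nat measure"
    by (intro pair_sigma_finite.intro sigma_finite_measure_count_space sigma_finite_measure_axioms)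
  interpret Q: pair_sigma_finite "count_space UNIV :: nat measure" M ..
  from u have m: "(\<lambda>(x, k). u k x) \<in> borel_measurable (M \<Otimes>\<^sub>M count_space UNIV)"
    and "integrable (M \<Otimes>\<^sub>M count_space UNIV) (\<lambda>(x, k). (u k x)\<^sup>2)"
    by (simp_all add: L2_def case_prod_unfold)
  then have int: "integrable (count_space UNIV \<Otimes>\<^sub>M M) (\<lambda>(k, x). (u k x)\<^sup>2)"
    using P.integrable_product_swap[of "\<lambda>(x, k). (u k x)\<^sup>2"] by (simp add: case_prod_unfold)
  have [measurable]: "u k \<in> borel_measurable M" for k
    using measurable_compose[OF measurable_Pair2'[of k "count_space UNIV" M] m] by simp
  have "AE k in count_space UNIV. integrable M (\<lambda>x. (u k x)\<^sup>2)"
    using Q.AE_integrable_fst'[OF int] by simp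
  then show "u k \<in> L2 M" for k
    by (simp add: AE_count_space L2_def)
  show "summable (\<lambda>k. \<integral>x. (u k x)\<^sup>2 \<partial>M)"
    using Q.integrable_fst'[OF int] by (simp add: integrable_count_space_nat_iff)
qed

subsection \<open>Kernels on tuples\<close>

lemma symmetric_fun_mset_eq:
  assumes "symmetric_fun n f" "mset ks = mset ls" "length ls = n"
  shows "f ks = f ls"
  using assms by (metis (mono_tags, lifting) mset_eq_permutation mem_Collect_eq symmetric_fun_def tuples_def)

text \<open>The tuples that share one product \<open>Y_prod\<close> are the orderings of one set;
  counting them is the source of every factor \<open>fact n\<close>.\<close>

lemma Delta_same_set:
  assumes "ks \<in> Delta n"
  shows "{ls \<in> Delta n. set ls = set ks} = permutations_of_set (set ks)"
  using assms by (auto simp: Delta_def tuples_def permutations_of_set_def distinct_card dest: distinct_card)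

lemma card_permutations_Delta:
  assumes "ks \<in> Delta n"
  shows "card (permutations_of_set (set ks)) = fact n"
  using assms by (auto simp: Delta_def tuples_def distinct_card)

lemma symmetric_fun_permutations:
  assumes "symmetric_fun n f" "ks \<in> Delta n" "ls \<in> permutations_of_set (set ks)"
  shows "f ls = f ks"
  using assms
  by (intro symmetric_fun_mset_eq[of n])
     (auto simp: Delta_def tuples_def permutations_of_set_def set_eq_iff_mset_eq_distinct)

lemma l2_summable_Delta:
  assumes "f \<in> l2 n"
  shows "(\<lambda>ks. (f ks)\<^sup>2) summable_on Delta n"
  using assms unfolding l2_def
  by (auto intro: summable_on_subset_banach simp: Delta_def)

lemma summable_on_mult_of_squares:
  fixes f g :: "'i \<Rightarrow> real"
  assumes "(\<lambda>i. (f i)\<^sup>2) summable_on I" "(\<lambda>i. (g i)\<^sup>2) summable_on I"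
  shows "(\<lambda>i. f i * g i) summable_on I"
proof (rule abs_summable_summable, rule summable_on_comparison_test)
  show "(\<lambda>i. (f i)\<^sup>2 + (g i)\<^sup>2) summable_on I"
    using assms by (rule summable_on_add)
qed (auto simp: abs_mult_le_sum_squares)

lemma l2_slice:
  assumes "f \<in> l2 (Suc n)"
  shows "slice f k \<in> l2 n"
proof -
  have inj: "inj_on (\<lambda>ks. ks @ [k]) (tuples n)"
    by (auto simp: inj_on_def)
  have "(\<lambda>ks. (f ks)\<^sup>2) summable_on (\<lambda>ks. ks @ [k]) ` tuples n"
    by (rule summable_on_subset_banach[of _ "tuples (Suc n)"])
       (use assms in \<open>auto simp: l2_def tuples_def\<close>)
  then show ?thesis
    by (simp add: l2_def slice_def summable_on_reindex[OF inj] o_def)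
qed

text \<open>Permuting a tuple preserves distinctness, so the cut-off in the kernels of the gradient
  respects symmetry.\<close>

lemma l2_sym_Delta:
  assumes "f \<in> l2_sym n"
  shows "(\<lambda>ks. f ks * indicator (Delta n) ks) \<in> l2_sym n"
proof -
  have "(\<lambda>ks. (f ks)\<^sup>2) summable_on tuples n"
    using assms by (simp add: l2_sym_def l2_def)
  then have "(\<lambda>ks. (f ks * indicator (Delta n) ks)\<^sup>2) summable_on tuples n"
    by (rule summable_on_comparison_test) (auto simp: indicator_def)
  moreover have "symmetric_fun n (\<lambda>ks. f ks * indicator (Delta n) ks)"
    unfolding symmetric_fun_def
  proof (intro ballI allI impI)
    fix ks \<pi> assume "ks \<in> tuples n" and perm: "\<pi> permutes {..<n}"
    then have "length ks = n" by (simp add: tuples_def)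
    moreover from this have "f (permute_list \<pi> ks) = f ks"
      using assms perm by (auto simp: l2_sym_def symmetric_fun_def tuples_def)
    moreover have "distinct (permute_list \<pi> ks) = distinct ks"
      using perm calculation(1) by (intro mset_eq_imp_distinct_iff mset_permute_list) simp
    ultimately show "f (permute_list \<pi> ks) * indicator (Delta n) (permute_list \<pi> ks)
        = f ks * indicator (Delta n) ks"
      by (simp add: indicator_def Delta_def tuples_def)
  qed
  ultimately show ?thesis by (simp add: l2_sym_def l2_def)
qed

lemma l2_sym_slice:
  assumes "f \<in> l2_sym (Suc n)"
  shows "slice f k \<in> l2_sym n"
proof -
  have "symmetric_fun n (slice f k)"
    unfolding symmetric_fun_def slice_def
  proof (intro ballI allI impI)
    fix ks \<pi> assume "ks \<in> tuples n" "\<pi> permutes {..<n}"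
    then show "f (permute_list \<pi> ks @ [k]) = f (ks @ [k])"
      using assms by (intro symmetric_fun_mset_eq[of "Suc n"]) (auto simp: l2_sym_def tuples_def)
  qed
  then show ?thesis using assms by (auto simp: l2_sym_def intro: l2_slice)
qed

lemma has_sum_sum:
  fixes f :: "'j \<Rightarrow> 'i \<Rightarrow> real"
  assumes "\<And>j. j \<in> K \<Longrightarrow> (f j has_sum s j) I"
  shows "((\<lambda>i. \<Sum>j\<in>K. f j i) has_sum (\<Sum>j\<in>K. s j)) I"
  using assms
proof (induction K rule: infinite_finite_induct)
  case (insert j K)
  have "((\<lambda>i. f j i + (\<Sum>j\<in>K. f j i)) has_sum (s j + (\<Sum>j\<in>K. s j))) I"
    using insert by (intro has_sum_add) auto
  then show ?case using insert.hyps by simp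
qed simp_all

section \<open>Symmetrization as an average of bijective reindexings\<close>

definition move_last :: "nat \<Rightarrow> nat list \<Rightarrow> nat list" where
  "move_last i ks = take i ks @ drop (Suc i) ks @ [ks ! i]"

lemma symmetrize_eq_sum_move_last:
  "symmetrize n f ks = (1 / real n) * (\<Sum>i<n. f (move_last i ks))"
  by (simp add: symmetrize_def move_last_def)

lemma mset_move_last:
  assumes "i < length ks"
  shows "mset (move_last i ks) = mset ks"
proof -
  have "mset (take i ks @ ks ! i # drop (Suc i) ks) = mset ks"
    using assms by (simp only: id_take_nth_drop[symmetric])
  then show ?thesis by (simp add: move_last_def)
qed

lemma bij_betw_move_last:
  assumes "i < n"
  shows "bij_betw (move_last i) (tuples n) (tuples n)"
\<comment> \<open>The inverse takes the last entry and reinserts it at position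
  \<open>i\<close>.\<close>
proof (rule bij_betw_byWitness[where f' = "\<lambda>ls. take i ls @ last ls # drop i (butlast ls)"])
  show "\<forall>ks\<in>tuples n. take i (move_last i ks) @ last (move_last i ks) # drop i (butlast (move_last i ks)) = ks"
  proof
    fix ks assume "ks \<in> tuples n"
    then have i: "i < length ks" using assms by (simp add: tuples_def)
    have eq: "move_last i ks = (take i ks @ drop (Suc i) ks) @ [ks ! i]"
      by (simp add: move_last_def)
    have "take i (move_last i ks) = take i ks" "last (move_last i ks) = ks ! i"
      "drop i (butlast (move_last i ks)) = drop (Suc i) ks"
      unfolding eq butlast_snoc last_snoc using i by simp_all
    then show "take i (move_last i ks) @ last (move_last i ks) # drop i (butlast (move_last i ks)) = ks"
      using i by (simp only: id_take_nth_drop[symmetric])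
  qed
  show "\<forall>ls\<in>tuples n. move_last i (take i ls @ last ls # drop i (butlast ls)) = ls"
  proof
    fix ls assume "ls \<in> tuples n"
    then have len: "length ls = n" and ne: "ls \<noteq> []" using assms by (auto simp: tuples_def)
    obtain xs x where ls: "ls = xs @ [x]" using ne by (cases ls rule: rev_cases) auto
    then show "move_last i (take i ls @ last ls # drop i (butlast ls)) = ls"
      using len assms by (simp add: move_last_def nth_append)
  qed
qed (use assms in \<open>auto simp: move_last_def tuples_def\<close>)

lemma bij_betw_move_last_Delta:
  assumes "i < n"
  shows "bij_betw (move_last i) (Delta n) (Delta n)"
proof (rule bij_betw_subset[OF bij_betw_move_last[OF assms]])
  have dist: "distinct (move_last i ks) = distinct ks" if "ks \<in> tuples n" for ks
    using assms that by (intro mset_eq_imp_distinct_iff mset_move_last) (auto simp: tuples_def)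
  show "move_last i ` Delta n = Delta n"
  proof (intro set_eqI iffI)
    fix ls assume "ls \<in> move_last i ` Delta n"
    then show "ls \<in> Delta n"
      using bij_betwE[OF bij_betw_move_last[OF assms]] dist by (auto simp: Delta_def)
  next
    fix ls assume ls: "ls \<in> Delta n"
    then obtain ks where "ks \<in> tuples n" "ls = move_last i ks"
      using bij_betw_imp_surj_on[OF bij_betw_move_last[OF assms]] by (auto simp: Delta_def)
    then show "ls \<in> move_last i ` Delta n"
      using ls dist by (auto simp: Delta_def)
  qed
qed (auto simp: Delta_def)

lemma l2_symmetrize:
  assumes "f \<in> l2 n"
  shows "symmetrize n f \<in> l2 n"
proof -
  obtain s where s: "((\<lambda>ks. (f ks)\<^sup>2) has_sum s) (tuples n)"
    using assms by (auto simp: l2_def summable_on_def)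
  have "((\<lambda>ks. \<Sum>i<n. (f (move_last i ks))\<^sup>2) has_sum (\<Sum>i<n. s)) (tuples n)"
  proof (rule has_sum_sum)
    fix i assume "i \<in> {..<n}"
    then have "bij_betw (move_last i) (tuples n) (tuples n)"
      by (simp add: bij_betw_move_last)
    from has_sum_reindex_bij_betw[OF this, of "\<lambda>ks. (f ks)\<^sup>2"]
    show "((\<lambda>ks. (f (move_last i ks))\<^sup>2) has_sum s) (tuples n)"
      using s by simp
  qed
  then have "(\<lambda>ks. \<Sum>i<n. (f (move_last i ks))\<^sup>2) summable_on tuples n"
    by (rule has_sum_imp_summable)
  \<comment> \<open>The factor is the squared weight of the average times the \<open>n\<close> from
    Cauchy-Schwarz for a sum of \<open>n\<close> terms.\<close>
  then have "(\<lambda>ks. ((1 / real n)\<^sup>2 * real n) * (\<Sum>i<n. (f (move_last i ks))\<^sup>2)) summable_on tuples n"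
    by (rule summable_on_cmult_right)
  then have "(\<lambda>ks. (symmetrize n f ks)\<^sup>2) summable_on tuples n"
  proof (rule summable_on_comparison_test)
    fix ks
    show "(symmetrize n f ks)\<^sup>2 \<le> ((1 / real n)\<^sup>2 * real n) * (\<Sum>i<n. (f (move_last i ks))\<^sup>2)"
      unfolding symmetrize_eq_sum_move_last power_mult_distrib mult.assoc
      using sum_squared_le_sum_of_squares[of "\<lambda>i. f (move_last i ks)" "{..<n}"]
      by (intro mult_left_mono) (auto simp: mult.commute)
  qed auto
  then show ?thesis by (simp add: l2_def)
qed

text \<open>Moving an entry to the last place permutes \<open>Delta n\<close> and leaves
  \<open>c\<close> unchanged, so each of the \<open>n\<close> reindexed series has the same sum
  \<open>s\<close>, and so does their average.\<close>

lemma has_sum_symmetrize: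
  assumes sum: "((\<lambda>ks. f ks * c ks) has_sum s) (Delta n)" and n: "0 < n"
    and c: "\<And>ks ls. ks \<in> Delta n \<Longrightarrow> ls \<in> Delta n \<Longrightarrow> set ks = set ls \<Longrightarrow> c ks = c ls"
  shows "((\<lambda>ks. symmetrize n f ks * c ks) has_sum s) (Delta n)"
proof -
  have "((\<lambda>ks. f (move_last i ks) * c ks) has_sum s) (Delta n)" if i: "i < n" for i
  proof -
    have "((\<lambda>ks. f (move_last i ks) * c (move_last i ks)) has_sum s) (Delta n)"
      using sum by (subst has_sum_reindex_bij_betw[OF bij_betw_move_last_Delta[OF i]])
    moreover have "c (move_last i ks) = c ks" if ks: "ks \<in> Delta n" for ks
    proof (rule c[OF _ ks])
      show "move_last i ks \<in> Delta n"
        using bij_betwE[OF bij_betw_move_last_Delta[OF i]] ks by blast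
      show "set (move_last i ks) = set ks"
        using ks i by (intro mset_eq_setD mset_move_last) (simp add: Delta_def tuples_def)
    qed
    ultimately show ?thesis by (simp cong: has_sum_cong)
  qed
  then have "((\<lambda>ks. \<Sum>i<n. f (move_last i ks) * c ks) has_sum (\<Sum>i<n. s)) (Delta n)"
    by (intro has_sum_sum) auto
  from has_sum_cmult_right[OF this, of "1 / real n"]
  show ?thesis
    using n by (simp add: symmetrize_eq_sum_move_last sum_distrib_right mult.assoc)
qed

text \<open>Splitting off the last entry makes \<open>Delta (Suc n)\<close> a disjoint union over
  \<open>k\<close>. The indicator discards the \<open>ks\<close> that contain \<open>k\<close>, so
  that each inner sum can run over all of \<open>Delta n\<close>, the index set of an integral of
  order \<open>n\<close>.\<close>

lemma has_sum_Delta_Suc: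
  fixes h :: "nat list \<Rightarrow> real"
  assumes sum: "(h has_sum s) (Delta (Suc n))"
    and slices: "\<And>k. ((\<lambda>ks. h (ks @ [k]) * indicator (Delta (Suc n)) (ks @ [k])) has_sum b k) (Delta n)"
  shows "(b has_sum s) UNIV"
proof (rule has_sum_SigmaD)
  let ?B = "\<lambda>k. {ks \<in> Delta n. ks @ [k] \<in> Delta (Suc n)}"
  show "((\<lambda>(k, ks). h (ks @ [k])) has_sum s) (Sigma UNIV ?B)"
  proof (subst has_sum_reindex_bij_witness[of _ "\<lambda>ls. (last ls, butlast ls)" "\<lambda>(k, ks). ks @ [k]" "Delta (Suc n)" h])
    fix ls assume "ls \<in> Delta (Suc n)"
    then show "(case (last ls, butlast ls) of (k, ks) \<Rightarrow> ks @ [k]) = ls"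
      and "(last ls, butlast ls) \<in> Sigma UNIV ?B"
      by (cases ls rule: rev_cases; auto simp: Delta_def tuples_def)+
  qed (use sum in auto)
  show "((\<lambda>ks. (\<lambda>(k, ks). h (ks @ [k])) (k, ks)) has_sum b k) (?B k)" for k
    using slices[of k] by (subst has_sum_cong_neutral[where T = "Delta n"]) (auto simp: indicator_def)
qed

subsection \<open>Independent coins\<close>

lemma measurable_coin: "(g :: real \<Rightarrow> real) \<in> borel_measurable (coin r)"
  by (simp add: coin_def)

lemma prob_space_coin:
  assumes "0 \<le> r" "r \<le> 1"
  shows "prob_space (coin r)"
  unfolding coin_def using assms
  by (intro prob_space_point_measure) (auto simp: ennreal_plus[symmetric] simp del: ennreal_plus)

lemma
  fixes g :: "real \<Rightarrow> real"
  assumes "0 \<le> r" "r \<le> 1"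
  shows integrable_coin: "integrable (coin r) g"
    and integral_coin: "(\<integral>x. g x \<partial>coin r) = r * g 1 + (1 - r) * g (-1)"
  using assms unfolding coin_def
  by (auto intro!: integrable_point_measure_finite simp: lebesgue_integral_point_measure_finite)

section \<open>Orthonormal products of the normalized coins\<close>

definition Y_prod :: "(nat \<Rightarrow> real) \<Rightarrow> nat set \<Rightarrow> (nat \<Rightarrow> real) \<Rightarrow> real" where
  "Y_prod p S \<omega> = (\<Prod>k\<in>S. Y p k \<omega>)"

lemma Y_prod_set:
  assumes "ks \<in> Delta n"
  shows "(\<Prod>i<n. Y p (ks ! i) \<omega>) = Y_prod p (set ks) \<omega>"
proof -
  have "bij_betw ((!) ks) {..<n} (set ks)"
    using assms by (intro bij_betw_nth) (auto simp: Delta_def tuples_def)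
  then show ?thesis
    unfolding Y_prod_def by (rule prod.reindex_bij_betw)
qed

locale coin_sequence =
  fixes p :: "nat \<Rightarrow> real"
  assumes p: "\<And>k. 0 < p k \<and> p k < 1"
begin

sublocale coins: product_prob_space "\<lambda>k. coin (p k)" UNIV
proof (intro product_prob_spaceI prob_space_coin)
  show "0 \<le> p k" "p k \<le> 1" for k using p[of k] by auto
qed

lemma prob_space_Omega: "prob_space (Omega p)"
  unfolding Omega_def by (rule coins.P.prob_space_axioms)

text \<open>Independence enters here: restriction to \<open>U\<close> pushes the law of the whole
  sequence to the finite product measure, on which Fubini factorizes the integral.\<close>

lemma
  fixes \<phi> :: "nat \<Rightarrow> real \<Rightarrow> real"
  assumes U: "finite U"
  shows integrable_Omega_prod: "integrable (Omega p) (\<lambda>\<omega>. \<Prod>k\<in>U. \<phi> k (\<omega> k))"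
    and integral_Omega_prod: "(\<integral>\<omega>. (\<Prod>k\<in>U. \<phi> k (\<omega> k)) \<partial>Omega p) = (\<Prod>k\<in>U. \<integral>x. \<phi> k x \<partial>coin (p k))"
proof -
  let ?P = "Pi\<^sub>M U (\<lambda>k. coin (p k))"
  have le: "0 \<le> p k" "p k \<le> 1" for k using p[of k] by auto
  have distr: "distr (Omega p) ?P (\<lambda>\<omega>. restrict \<omega> U) = ?P"
    unfolding Omega_def by (rule coins.distr_PiM_restrict_finite) (use U in auto)
  have [measurable]: "(\<lambda>\<omega>. restrict \<omega> U) \<in> Omega p \<rightarrow>\<^sub>M ?P"
    unfolding Omega_def by (rule measurable_restrict_subset) simp
  have int: "integrable ?P (\<lambda>x. \<Prod>k\<in>U. \<phi> k (x k))"
    using U by (intro coins.product_integrable_prod integrable_coin le)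
  have eq: "(\<Prod>k\<in>U. \<phi> k (restrict \<omega> U k)) = (\<Prod>k\<in>U. \<phi> k (\<omega> k))" for \<omega>
    by (intro prod.cong) auto
  from int have "integrable (distr (Omega p) ?P (\<lambda>\<omega>. restrict \<omega> U)) (\<lambda>x. \<Prod>k\<in>U. \<phi> k (x k))"
    by (simp only: distr)
  then show "integrable (Omega p) (\<lambda>\<omega>. \<Prod>k\<in>U. \<phi> k (\<omega> k))"
    by (subst (asm) integrable_distr_eq) (auto simp: eq borel_measurable_integrable[OF int])
  have "(\<Prod>k\<in>U. \<integral>x. \<phi> k x \<partial>coin (p k)) = (\<integral>x. (\<Prod>k\<in>U. \<phi> k (x k)) \<partial>?P)"
    using U by (intro coins.product_integral_prod[symmetric] integrable_coin le)
  also have "\<dots> = (\<integral>x. (\<Prod>k\<in>U. \<phi> k (x k)) \<partial>distr (Omega p) ?P (\<lambda>\<omega>. restrict \<omega> U))"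
    by (simp only: distr)
  also have "\<dots> = (\<integral>\<omega>. (\<Prod>k\<in>U. \<phi> k (restrict \<omega> U k)) \<partial>Omega p)"
    by (rule integral_distr) (auto simp: borel_measurable_integrable[OF int])
  finally show "(\<integral>\<omega>. (\<Prod>k\<in>U. \<phi> k (\<omega> k)) \<partial>Omega p) = (\<Prod>k\<in>U. \<integral>x. \<phi> k x \<partial>coin (p k))"
    by (simp only: eq)
qed

lemma
  assumes S: "finite S" and T: "finite T"
  shows integrable_Y_prod_mult: "integrable (Omega p) (\<lambda>\<omega>. Y_prod p S \<omega> * Y_prod p T \<omega>)"
    and integral_Y_prod_mult:
      "(\<integral>\<omega>. Y_prod p S \<omega> * Y_prod p T \<omega> \<partial>Omega p) = (if S = T then 1 else 0)"
proof -
  define y where "y k x = ((1 - p k) - p k + x) / (2 * sqrt (p k * (1 - p k)))" for k x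
  \<comment> \<open>With the default factor 1, the single function \<open>\<phi> k\<close> is the
    square of \<open>y k\<close> on S \<inter> T and \<open>y k\<close> itself on the symmetric
    difference, where its mean 0 makes the product vanish.\<close>
  define \<phi> where "\<phi> k x = (if k \<in> S then y k x else 1) * (if k \<in> T then y k x else 1)" for k x
  have Y: "Y p k \<omega> = y k (\<omega> k)" for k \<omega>
    by (simp add: Y_def X_def y_def)
  have "Y_prod p S \<omega> * Y_prod p T \<omega> = (\<Prod>k\<in>S \<union> T. \<phi> k (\<omega> k))" for \<omega>
  proof -
    have "(\<Prod>k\<in>S \<union> T. if k \<in> A then y k (\<omega> k) else 1) = Y_prod p A \<omega>" if "A \<subseteq> S \<union> T" for A
      using that S T by (subst prod.inter_restrict[symmetric]) (auto simp: Y_prod_def Y Int_absorb1)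
    then show ?thesis by (simp add: \<phi>_def prod.distrib)
  qed
  note eq = this
  show "integrable (Omega p) (\<lambda>\<omega>. Y_prod p S \<omega> * Y_prod p T \<omega>)"
    unfolding eq using S T by (intro integrable_Omega_prod) auto
  have mean: "(\<integral>x. y k x \<partial>coin (p k)) = 0" and var: "(\<integral>x. y k x * y k x \<partial>coin (p k)) = 1" for k
  proof -
    have k: "0 < p k" "p k < 1" using p[of k] by auto
    define s where "s = sqrt (p k * (1 - p k))"
    have s: "s * s = p k * (1 - p k)" "s \<noteq> 0"
      using k by (auto simp: s_def)
    \<comment> \<open>The two values of the normalized coin are q/s and -p/s with s^2 = p q, which
      gives mean 0 and variance 1.\<close>
    have y1: "y k 1 = (1 - p k) / s" and y2: "y k (-1) = - p k / s"
      using s(2) by (simp_all add: y_def divide_simps flip: s_def)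
    show "(\<integral>x. y k x \<partial>coin (p k)) = 0"
      using k by (subst integral_coin) (auto simp: y1 y2)
    have "(\<integral>x. y k x * y k x \<partial>coin (p k)) =
      (p k * (1 - p k)\<^sup>2 + (1 - p k) * (p k)\<^sup>2) / (s * s)"
      using k by (subst integral_coin) (auto simp: y1 y2 power2_eq_square add_divide_distrib)
    also have "\<dots> = (p k * (1 - p k)) / (p k * (1 - p k))"
      unfolding s(1) by (simp add: power2_eq_square algebra_simps)
    finally show "(\<integral>x. y k x * y k x \<partial>coin (p k)) = 1"
      using k by simp
  qed
  have "(\<integral>x. \<phi> k x \<partial>coin (p k)) = (if k \<in> S \<inter> T then 1 else 0)" if "k \<in> S \<union> T" for k
    using that by (auto simp: \<phi>_def mean var)
  then have "(\<integral>\<omega>. Y_prod p S \<omega> * Y_prod p T \<omega> \<partial>Omega p) = (\<Prod>k\<in>S \<union> T. if k \<in> S \<inter> T then 1 else 0)"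
    unfolding eq using S T by (subst integral_Omega_prod) auto
  also have "\<dots> = (if S = T then 1 else 0)"
  proof (cases "S = T")
    case False
    then obtain k where "k \<in> S \<union> T" "k \<notin> S \<inter> T" by blast
    then show ?thesis using S T False by (auto intro!: prod_zero)
  qed auto
  finally show "(\<integral>\<omega>. Y_prod p S \<omega> * Y_prod p T \<omega> \<partial>Omega p) = (if S = T then 1 else 0)" .
qed

lemma Y_measurable: "Y p k \<in> borel_measurable (Omega p)"
proof -
  have "(\<lambda>\<omega>. \<omega> k) \<in> Omega p \<rightarrow>\<^sub>M coin (p k)"
    unfolding Omega_def by (rule measurable_component_singleton) simp
  from measurable_compose[OF this measurable_coin] show ?thesis
    unfolding Y_def X_def .
qed

lemma Y_prod_L2:
  assumes "finite S"
  shows "Y_prod p S \<in> L2 (Omega p)"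
proof -
  have "Y_prod p S \<in> borel_measurable (Omega p)"
    unfolding Y_prod_def by (intro borel_measurable_prod Y_measurable)
  then show ?thesis
    using integrable_Y_prod_mult[OF assms assms] by (simp add: L2_def power2_eq_square)
qed

subsection \<open>Multiple stochastic integrals\<close>

text \<open>Schur's test for the Gram matrix of the products: its entries are 0 or 1, it is
  symmetric, and each row contains at most n! ones.\<close>

lemma integral_sum_Y_prod_square_le:
  assumes A: "finite A" "A \<subseteq> Delta n"
  shows "(\<integral>\<omega>. (\<Sum>ks\<in>A. f ks * Y_prod p (set ks) \<omega>)\<^sup>2 \<partial>Omega p) \<le> fact n * (\<Sum>ks\<in>A. (f ks)\<^sup>2)"
proof -
  define \<delta> :: "nat list \<Rightarrow> nat list \<Rightarrow> real"
    where "\<delta> ks ls = (if set ks = set ls then 1 else 0)" for ks ls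
  have \<delta>_sum: "(\<Sum>ls\<in>A. \<delta> ks ls) \<le> fact n" if "ks \<in> A" for ks
  proof -
    have "(\<Sum>ls\<in>A. \<delta> ks ls) = real (card {ls \<in> A. set ls = set ks})"
      using A by (simp add: \<delta>_def sum.If_cases Int_def eq_commute)
    also have "\<dots> \<le> real (card (permutations_of_set (set ks)))"
      using A that Delta_same_set[of ks n] by (intro of_nat_mono card_mono) auto
    also have "\<dots> = fact n"
      using that A by (subst card_permutations_Delta[of ks n]) auto
    finally show ?thesis .
  qed
  have "(\<Sum>ks\<in>A. f ks * Y_prod p (set ks) \<omega>)\<^sup>2 =
      (\<Sum>ks\<in>A. \<Sum>ls\<in>A. f ks * f ls * (Y_prod p (set ks) \<omega> * Y_prod p (set ls) \<omega>))" for \<omega>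
    by (simp add: power2_eq_square sum_product mult_ac)
  then have "(\<integral>\<omega>. (\<Sum>ks\<in>A. f ks * Y_prod p (set ks) \<omega>)\<^sup>2 \<partial>Omega p) = (\<Sum>ks\<in>A. \<Sum>ls\<in>A. f ks * f ls * \<delta> ks ls)"
    by (simp add: integrable_Y_prod_mult integral_Y_prod_mult \<delta>_def)
  \<comment> \<open>AM-GM on each entry. The second half is written with
    \<open>\<delta> ls ks\<close>, so that exchanging the two sums turns it into the first
    half.\<close>
  also have "\<dots> \<le> (\<Sum>ks\<in>A. \<Sum>ls\<in>A. (f ks)\<^sup>2 * \<delta> ks ls / 2 + (f ls)\<^sup>2 * \<delta> ls ks / 2)"
  proof (intro sum_mono)
    fix ks ls
    show "f ks * f ls * \<delta> ks ls \<le> (f ks)\<^sup>2 * \<delta> ks ls / 2 + (f ls)\<^sup>2 * \<delta> ls ks / 2"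
      using sum_squares_bound[of "f ks" "f ls"] by (auto simp: \<delta>_def)
  qed
  also have "\<dots> = (\<Sum>ks\<in>A. \<Sum>ls\<in>A. (f ks)\<^sup>2 * \<delta> ks ls / 2) + (\<Sum>ks\<in>A. \<Sum>ls\<in>A. (f ls)\<^sup>2 * \<delta> ls ks / 2)"
    by (simp only: sum.distrib)
  also have "(\<Sum>ks\<in>A. \<Sum>ls\<in>A. (f ls)\<^sup>2 * \<delta> ls ks / 2) = (\<Sum>ks\<in>A. \<Sum>ls\<in>A. (f ks)\<^sup>2 * \<delta> ks ls / 2)"
    by (rule sum.swap)
  also have "(\<Sum>ks\<in>A. \<Sum>ls\<in>A. (f ks)\<^sup>2 * \<delta> ks ls / 2) + (\<Sum>ks\<in>A. \<Sum>ls\<in>A. (f ks)\<^sup>2 * \<delta> ks ls / 2) =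
      (\<Sum>ks\<in>A. (f ks)\<^sup>2 * (\<Sum>ls\<in>A. \<delta> ks ls))"
    by (simp add: sum_distrib_left flip: sum_divide_distrib)
  also have "\<dots> \<le> (\<Sum>ks\<in>A. (f ks)\<^sup>2 * fact n)"
    by (intro sum_mono mult_left_mono \<delta>_sum) auto
  finally show ?thesis by (simp add: sum_distrib_left mult.commute)
qed

text \<open>The Bessel bound and completeness show that a limit exists, so the choice made by
  \<open>SOME\<close> has its defining property.\<close>

lemma J_L2_limit:
  assumes f: "f \<in> l2 n"
  shows "J p n f \<in> L2 (Omega p)"
    and "((\<lambda>A. \<integral>\<omega>. (J p n f \<omega> - (\<Sum>ks\<in>A. f ks * Y_prod p (set ks) \<omega>))\<^sup>2 \<partial>Omega p) \<longlongrightarrow> 0)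
      (finite_subsets_at_top (Delta n))"
proof -
  interpret O: prob_space "Omega p" by (rule prob_space_Omega)
  let ?P = "\<lambda>F. F \<in> L2 (Omega p) \<and>
    ((\<lambda>A. \<integral>\<omega>. (F \<omega> - (\<Sum>ks\<in>A. f ks * Y_prod p (set ks) \<omega>))\<^sup>2 \<partial>Omega p) \<longlongrightarrow> 0)
      (finite_subsets_at_top (Delta n))"
  have "?P (J p n f)"
  proof (cases "n = 0")
    case True
    \<comment> \<open>Order 0 has its own clause in \<open>J\<close>, but fits the same limit: the
      only tuple is \<open>[]\<close> and its empty product is 1.\<close>
    have Delta_0: "Delta 0 = {[]}" by (auto simp: Delta_def tuples_def)
    have "\<forall>\<^sub>F A in finite_subsets_at_top (Delta 0).
        (\<integral>\<omega>. (J p 0 f \<omega> - (\<Sum>ks\<in>A. f ks * Y_prod p (set ks) \<omega>))\<^sup>2 \<partial>Omega p) = 0"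
      by (simp add: Delta_0 finite_subsets_at_top_finite eventually_principal J_def Y_prod_def)
    then show ?thesis
      using True by (auto simp: J_def L2_def intro: tendsto_eventually)
  next
    case False
    \<comment> \<open>A product over positions is one over the set of entries only for distinct
      tuples, hence the restriction to subsets of \<open>Delta n\<close>, which are all that the net
      sees.\<close>
    have "(\<Sum>ks\<in>A. f ks * (\<Prod>i<n. Y p (ks ! i) \<omega>)) = (\<Sum>ks\<in>A. f ks * Y_prod p (set ks) \<omega>)"
      if "A \<subseteq> Delta n" for A \<omega>
      using that by (intro sum.cong refl) (auto simp: Y_prod_set)
    then have "((\<lambda>A. \<integral>\<omega>. (F \<omega> - (\<Sum>ks\<in>A. f ks * (\<Prod>i<n. Y p (ks ! i) \<omega>)))\<^sup>2 \<partial>Omega p) \<longlongrightarrow> 0)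
        (finite_subsets_at_top (Delta n)) \<longleftrightarrow>
      ((\<lambda>A. \<integral>\<omega>. (F \<omega> - (\<Sum>ks\<in>A. f ks * Y_prod p (set ks) \<omega>))\<^sup>2 \<partial>Omega p) \<longlongrightarrow> 0)
        (finite_subsets_at_top (Delta n))" for F
      by (intro tendsto_cong eventually_finite_subsets_at_top_weakI) simp
    then have J: "J p n f = (SOME F. ?P F)"
      using False by (simp add: J_def)
    obtain F where "?P F"
    proof (rule L2_unconditional_sum[OF prob_space_Omega, where e = "\<lambda>ks. Y_prod p (set ks)"
          and f = f and I = "Delta n" and C = "fact n"])
      show "Y_prod p (set ks) \<in> L2 (Omega p)" for ks by (rule Y_prod_L2) simp
      show "(\<lambda>ks. (f ks)\<^sup>2) summable_on Delta n" by (rule l2_summable_Delta[OF f])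
    qed (auto intro: integral_sum_Y_prod_square_le)
    then show ?thesis unfolding J by (rule someI[of ?P])
  qed
  then show "J p n f \<in> L2 (Omega p)"
    and "((\<lambda>A. \<integral>\<omega>. (J p n f \<omega> - (\<Sum>ks\<in>A. f ks * Y_prod p (set ks) \<omega>))\<^sup>2 \<partial>Omega p) \<longlongrightarrow> 0)
      (finite_subsets_at_top (Delta n))" by blast+
qed

lemma J_inner_has_sum:
  assumes "f \<in> l2 n" "G \<in> L2 (Omega p)"
  shows "((\<lambda>ks. f ks * (\<integral>\<omega>. Y_prod p (set ks) \<omega> * G \<omega> \<partial>Omega p)) has_sum
    (\<integral>\<omega>. J p n f \<omega> * G \<omega> \<partial>Omega p)) (Delta n)"
  using assms by (intro L2_inner_has_sum J_L2_limit Y_prod_L2) auto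

text \<open>Orthonormality keeps only the orderings of \<open>set ks\<close>. For equal orders there
  are n! of them, with equal values of \<open>f\<close> by symmetry; for different orders the
  cardinalities exclude any match.\<close>

lemma J_coefficient:
  assumes f: "f \<in> l2_sym n" and ks: "ks \<in> Delta m"
  shows "(\<integral>\<omega>. Y_prod p (set ks) \<omega> * J p n f \<omega> \<partial>Omega p) = (if n = m then fact n * f ks else 0)"
proof -
  have f2: "f \<in> l2 n" using f by (simp add: l2_sym_def)
  have "((\<lambda>ls. f ls * (if set ls = set ks then 1 else 0)) has_sum
      (\<integral>\<omega>. Y_prod p (set ks) \<omega> * J p n f \<omega> \<partial>Omega p)) (Delta n)"
    using J_inner_has_sum[OF f2 Y_prod_L2[of "set ks"]] by (simp add: integral_Y_prod_mult mult.commute)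
  moreover have "((\<lambda>ls. f ls * (if set ls = set ks then 1 else 0)) has_sum
      (if n = m then fact n * f ks else 0)) (Delta n)"
  proof (cases "n = m")
    case True
    have "((\<lambda>ls. f ks) has_sum (\<Sum>ls\<in>permutations_of_set (set ks). f ks)) (permutations_of_set (set ks))"
      by (rule has_sum_finite) simp
    moreover have "(\<Sum>ls\<in>permutations_of_set (set ks). f ks) = fact n * f ks"
      using card_permutations_Delta[OF ks] True by simp
    ultimately have "((\<lambda>ls. f ks) has_sum fact n * f ks) (permutations_of_set (set ks))"
      by (simp only:)
    also have "?this \<longleftrightarrow> ((\<lambda>ls. f ls * (if set ls = set ks then 1 else 0)) has_sum fact n * f ks) (Delta n)"
      using f ks True
      by (intro has_sum_cong_neutral)
         (auto simp: Delta_same_set[symmetric] l2_sym_def intro!: symmetric_fun_permutations[of n f, symmetric])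
    finally show ?thesis using True by simp
  next
    case False
    have "set ls \<noteq> set ks" if "ls \<in> Delta n" for ls
      using that ks False by (auto simp: Delta_def tuples_def) (metis distinct_card)
    then show ?thesis using False by (auto intro!: has_sum_0)
  qed
  ultimately show ?thesis by (rule has_sum_unique)
qed

section \<open>Finite sums of integrals and their coefficients\<close>

lemma sum_J_L2:
  assumes "\<And>j. j \<in> I \<Longrightarrow> f j \<in> l2 (d j)"
  shows "(\<lambda>\<omega>. \<Sum>j\<in>I. a j * J p (d j) (f j) \<omega>) \<in> L2 (Omega p)"
  using assms by (intro L2_sum L2_cmult J_L2_limit)

text \<open>Free weights \<open>a\<close> and orders \<open>d\<close> serve the expansion of
  \<open>F\<close> (1 and \<open>j\<close>), the gradient (\<open>j\<close> and
  \<open>j - 1\<close>) and the divergence (1 and \<open>Suc j\<close>).\<close>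

lemma inner_sum_J:
  assumes f: "\<And>j. j \<in> I \<Longrightarrow> f j \<in> l2 (d j)" and G: "G \<in> L2 (Omega p)"
  shows "(\<integral>\<omega>. G \<omega> * (\<Sum>j\<in>I. a j * J p (d j) (f j) \<omega>) \<partial>Omega p) =
    (\<Sum>j\<in>I. a j * (\<integral>\<omega>. J p (d j) (f j) \<omega> * G \<omega> \<partial>Omega p))"
proof -
  have "(\<integral>\<omega>. G \<omega> * (\<Sum>j\<in>I. a j * J p (d j) (f j) \<omega>) \<partial>Omega p) =
      (\<integral>\<omega>. (\<Sum>j\<in>I. a j * (J p (d j) (f j) \<omega> * G \<omega>)) \<partial>Omega p)"
    by (simp add: sum_distrib_left mult_ac)
  also have "\<dots> = (\<Sum>j\<in>I. \<integral>\<omega>. a j * (J p (d j) (f j) \<omega> * G \<omega>) \<partial>Omega p)"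
    by (intro Bochner_Integration.integral_sum integrable_mult_right L2_mult_integrable J_L2_limit f G)
  finally show ?thesis by simp
qed

text \<open>Defined from \<open>F\<close> alone and without dividing by n!, so it does not refer to
  a chosen expansion and the factor \<open>j\<close> of the gradient is absorbed.\<close>

definition chaos_coeff :: "((nat \<Rightarrow> real) \<Rightarrow> real) \<Rightarrow> nat list \<Rightarrow> real" where
  "chaos_coeff F ks = (\<integral>\<omega>. Y_prod p (set ks) \<omega> * F \<omega> \<partial>Omega p)"

lemma chaos_coeff_expansion:
  assumes F: "chaos_expansion p F N f" and ks: "ks \<in> Delta n"
  shows "chaos_coeff F ks = (if n \<le> N then fact n * f n ks else 0)"
proof -
  have FL: "F \<in> L2 (Omega p)" and f: "\<And>j. j \<le> N \<Longrightarrow> f j \<in> l2_sym j"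
    and AE: "AE \<omega> in Omega p. F \<omega> = (\<Sum>j\<le>N. J p j (f j) \<omega>)"
    using F by (auto simp: chaos_expansion_def)
  have f2: "f j \<in> l2 j" if "j \<in> {..N}" for j using f[of j] that by (simp add: l2_sym_def)
  have SL: "(\<lambda>\<omega>. \<Sum>j\<le>N. J p j (f j) \<omega>) \<in> L2 (Omega p)"
    by (intro L2_sum J_L2_limit f2)
  have YL: "Y_prod p (set ks) \<in> L2 (Omega p)" by (simp add: Y_prod_L2)
  have "chaos_coeff F ks = (\<integral>\<omega>. Y_prod p (set ks) \<omega> * (\<Sum>j\<le>N. J p j (f j) \<omega>) \<partial>Omega p)"
    unfolding chaos_coeff_def
  proof (rule integral_cong_AE)
    show "AE \<omega> in Omega p. Y_prod p (set ks) \<omega> * F \<omega> = Y_prod p (set ks) \<omega> * (\<Sum>j\<le>N. J p j (f j) \<omega>)"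
      using AE by eventually_elim simp
  qed (intro borel_measurable_times L2_borel_measurable YL FL SL)+
  also have "\<dots> = (\<Sum>j\<le>N. \<integral>\<omega>. J p j (f j) \<omega> * Y_prod p (set ks) \<omega> \<partial>Omega p)"
    using inner_sum_J[of "{..N}" f "\<lambda>j. j", OF f2 YL, of "\<lambda>_. 1"] by simp
  also have "\<dots> = (\<Sum>j\<le>N. if j = n then fact n * f n ks else 0)"
    by (intro sum.cong refl) (auto simp: J_coefficient[OF f ks] mult.commute[of "J p _ _ _"])
  finally show ?thesis by simp
qed

text \<open>On \<open>Delta n\<close> the coefficient is n! times a square-summable kernel, or 0.
  Hence its product with any square-summable kernel is summable.\<close>

lemma chaos_coeff_square_summable:
  assumes "chaos_expansion p F N f"
  shows "(\<lambda>ks. (chaos_coeff F ks)\<^sup>2) summable_on Delta n"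
proof (cases "n \<le> N")
  case True
  then have "(\<lambda>ks. (f n ks)\<^sup>2) summable_on Delta n"
    using assms by (intro l2_summable_Delta) (auto simp: chaos_expansion_def l2_sym_def)
  then have "(\<lambda>ks. (fact n)\<^sup>2 * (f n ks)\<^sup>2) summable_on Delta n"
    by (rule summable_on_cmult_right)
  then show ?thesis
    using True by (simp add: chaos_coeff_expansion[OF assms] power_mult_distrib cong: summable_on_cong)
next
  case False
  then show ?thesis
    by (simp add: chaos_coeff_expansion[OF assms] cong: summable_on_cong)
qed

subsection \<open>Duality\<close>

lemma chaos_coeff_cong:
  assumes "set ks = set ls"
  shows "chaos_coeff F ks = chaos_coeff F ls"
  by (simp add: chaos_coeff_def assms)

text \<open>The candidate attached to one given expansion; \<open>gradient\<close> selects one of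
  these, and \<open>divergence\<close> likewise one of the functions defined next.\<close>

definition gradient_of :: "nat \<Rightarrow> (nat \<Rightarrow> nat list \<Rightarrow> real) \<Rightarrow> nat \<Rightarrow> (nat \<Rightarrow> real) \<Rightarrow> real" where
  "gradient_of N f k \<omega> =
    (\<Sum>j=1..N. real j * J p (j - 1) (slice (\<lambda>ks. f j ks * indicator (Delta j) ks) k) \<omega>)"

definition divergence_of :: "nat \<Rightarrow> (nat \<Rightarrow> nat list \<Rightarrow> real) \<Rightarrow> (nat \<Rightarrow> real) \<Rightarrow> real" where
  "divergence_of M g \<omega> = (\<Sum>j\<le>M. J p (Suc j) (symmetrize (Suc j) (g (Suc j))) \<omega>)"

lemma gradient_kernel:
  assumes F: "chaos_expansion p F N f" and j: "j \<in> {1..N}"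
  shows "slice (\<lambda>ks. f j ks * indicator (Delta j) ks) k \<in> l2_sym (j - 1)"
    and "slice (\<lambda>ks. f j ks * indicator (Delta j) ks) k \<in> l2 (j - 1)"
proof -
  have "f j \<in> l2_sym j" using F j by (auto simp: chaos_expansion_def)
  from l2_sym_Delta[OF this] have "(\<lambda>ks. f j ks * indicator (Delta j) ks) \<in> l2_sym (Suc (j - 1))"
    using j by simp
  then show "slice (\<lambda>ks. f j ks * indicator (Delta j) ks) k \<in> l2_sym (j - 1)"
    by (rule l2_sym_slice)
  then show "slice (\<lambda>ks. f j ks * indicator (Delta j) ks) k \<in> l2 (j - 1)"
    by (simp add: l2_sym_def)
qed

lemma gradient_of_L2:
  assumes "chaos_expansion p F N f"
  shows "gradient_of N f k \<in> L2 (Omega p)"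
  unfolding gradient_of_def by (rule sum_J_L2) (rule gradient_kernel[OF assms])

text \<open>Only the term \<open>j = Suc n\<close> has integrals of order \<open>n\<close>, and its
  weight gives (n+1) n! = (n+1)!, the factor in the coefficient of \<open>F\<close> at order
  \<open>Suc n\<close>.\<close>

lemma chaos_coeff_gradient_of:
  assumes F: "chaos_expansion p F N f" and ks: "ks \<in> Delta n"
  shows "chaos_coeff (gradient_of N f k) ks = chaos_coeff F (ks @ [k]) * indicator (Delta (Suc n)) (ks @ [k])"
proof -
  let ?h = "\<lambda>j. slice (\<lambda>ks. f j ks * indicator (Delta j) ks) k"
  have YL: "Y_prod p (set ks) \<in> L2 (Omega p)" by (simp add: Y_prod_L2)
  have "chaos_coeff (gradient_of N f k) ks =
      (\<Sum>j=1..N. real j * (\<integral>\<omega>. J p (j - 1) (?h j) \<omega> * Y_prod p (set ks) \<omega> \<partial>Omega p))"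
    unfolding chaos_coeff_def gradient_of_def
    by (rule inner_sum_J[where f = ?h and d = "\<lambda>j. j - 1"]) (rule gradient_kernel[OF F], assumption, rule YL)
  also have "\<dots> = (\<Sum>j=1..N. if j = Suc n then fact (Suc n) * ?h (Suc n) ks else 0)"
  proof (intro sum.cong refl)
    fix j assume j: "j \<in> {1..N}"
    have "(\<integral>\<omega>. J p (j - 1) (?h j) \<omega> * Y_prod p (set ks) \<omega> \<partial>Omega p) =
        (if j - 1 = n then fact (j - 1) * ?h j ks else 0)"
      unfolding mult.commute[of "J p _ _ _"] by (rule J_coefficient[OF gradient_kernel(1)[OF F j] ks])
    then show "real j * (\<integral>\<omega>. J p (j - 1) (?h j) \<omega> * Y_prod p (set ks) \<omega> \<partial>Omega p) =
        (if j = Suc n then fact (Suc n) * ?h (Suc n) ks else 0)"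
      using j by auto
  qed
  also have "\<dots> = (if Suc n \<le> N then fact (Suc n) * ?h (Suc n) ks else 0)"
    by (simp add: sum.delta del: fact_Suc)
  \<comment> \<open>If k occurs in \<open>ks\<close>, both sides vanish through the indicator;
    otherwise the formula for the coefficients of \<open>F\<close> applies, including its value 0
    above order \<open>N\<close>.\<close>
  also have "\<dots> = chaos_coeff F (ks @ [k]) * indicator (Delta (Suc n)) (ks @ [k])"
    by (cases "ks @ [k] \<in> Delta (Suc n)")
       (simp_all add: chaos_coeff_expansion[OF F] slice_def del: fact_Suc)
  finally show ?thesis .
qed

text \<open>The duality for one kernel: for each \<open>k\<close> the inner product is a sum over
  \<open>Delta n\<close> of \<open>g\<close> times a coefficient of \<open>F\<close>, and summing
  over \<open>k\<close> reassembles \<open>Delta (Suc n)\<close>.\<close>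

lemma has_sum_inner_gradient_of:
  assumes F: "chaos_expansion p F N f" and g: "g \<in> l2 (Suc n)"
  shows "((\<lambda>k. \<integral>\<omega>. J p n (slice g k) \<omega> * gradient_of N f k \<omega> \<partial>Omega p) has_sum
    (\<Sum>\<^sub>\<infinity>ks\<in>Delta (Suc n). g ks * chaos_coeff F ks)) UNIV"
proof (rule has_sum_Delta_Suc)
  show "((\<lambda>ks. g ks * chaos_coeff F ks) has_sum (\<Sum>\<^sub>\<infinity>ks\<in>Delta (Suc n). g ks * chaos_coeff F ks)) (Delta (Suc n))"
    by (intro has_sum_infsum summable_on_mult_of_squares l2_summable_Delta[OF g]
        chaos_coeff_square_summable[OF F])
  fix k
  have "((\<lambda>ks. slice g k ks * chaos_coeff (gradient_of N f k) ks) has_sum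
      (\<integral>\<omega>. J p n (slice g k) \<omega> * gradient_of N f k \<omega> \<partial>Omega p)) (Delta n)"
    unfolding chaos_coeff_def by (intro J_inner_has_sum l2_slice g gradient_of_L2[OF F])
  then show "((\<lambda>ks. g (ks @ [k]) * chaos_coeff F (ks @ [k]) * indicator (Delta (Suc n)) (ks @ [k])) has_sum
      (\<integral>\<omega>. J p n (slice g k) \<omega> * gradient_of N f k \<omega> \<partial>Omega p)) (Delta n)"
    by (rule has_sum_cong[THEN iffD1, rotated]) (simp add: chaos_coeff_gradient_of[OF F] slice_def mult.assoc)
qed

text \<open>Writing one of the two factors of the square as its sum of integrals reduces the claim
  to the preceding lemma, with the kernels of \<open>F\<close> itself in the role of
  \<open>g\<close>.\<close>

lemma summable_gradient_of_square:
  assumes F: "chaos_expansion p F N f"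
  shows "summable (\<lambda>k. \<integral>\<omega>. (gradient_of N f k \<omega>)\<^sup>2 \<partial>Omega p)"
proof -
  let ?h = "\<lambda>j ks. f j ks * indicator (Delta j) ks"
  have h: "?h j \<in> l2 (Suc (j - 1))" if "j \<in> {1..N}" for j
    using l2_sym_Delta[of "f j" j] F that by (auto simp: chaos_expansion_def l2_sym_def)
  have "(\<integral>\<omega>. (gradient_of N f k \<omega>)\<^sup>2 \<partial>Omega p) =
      (\<Sum>j=1..N. real j * (\<integral>\<omega>. J p (j - 1) (slice (?h j) k) \<omega> * gradient_of N f k \<omega> \<partial>Omega p))" for k
  proof -
    have "(\<integral>\<omega>. (gradient_of N f k \<omega>)\<^sup>2 \<partial>Omega p) = (\<integral>\<omega>. gradient_of N f k \<omega> *
        (\<Sum>j=1..N. real j * J p (j - 1) (slice (?h j) k) \<omega>) \<partial>Omega p)"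
      by (simp add: power2_eq_square gradient_of_def)
    also have "\<dots> = (\<Sum>j=1..N. real j * (\<integral>\<omega>. J p (j - 1) (slice (?h j) k) \<omega> * gradient_of N f k \<omega> \<partial>Omega p))"
      by (rule inner_sum_J[where f = "\<lambda>j. slice (?h j) k" and d = "\<lambda>j. j - 1"])
         (rule gradient_kernel[OF F], assumption, rule gradient_of_L2[OF F])
    finally show ?thesis .
  qed
  moreover have "summable (\<lambda>k. \<Sum>j=1..N. real j *
      (\<integral>\<omega>. J p (j - 1) (slice (?h j) k) \<omega> * gradient_of N f k \<omega> \<partial>Omega p))"
  proof (intro summable_sum summable_mult)
    fix j assume "j \<in> {1..N}"
    from has_sum_imp_sums[OF has_sum_inner_gradient_of[OF F h[OF this]]]
    show "summable (\<lambda>k. \<integral>\<omega>. J p (j - 1) (slice (?h j) k) \<omega> * gradient_of N f k \<omega> \<partial>Omega p)"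
      by (rule sums_summable)
  qed
  ultimately show ?thesis by (simp only:)
qed

text \<open>The two expansions are arbitrary, so the result applies to whichever ones the choice
  operators select.\<close>

lemma duality_expansions:
  assumes F: "chaos_expansion p F N f" and u: "process_expansion p u M g"
  shows "(\<integral>\<omega>. (\<Sum>\<^sub>\<infinity>k. gradient_of N f k \<omega> * u k \<omega>) \<partial>Omega p) = (\<integral>\<omega>. F \<omega> * divergence_of M g \<omega> \<partial>Omega p)"
proof -
  \<comment> \<open>The common value of both sides, in which only the kernels \<open>g\<close> and
    the coefficients of \<open>F\<close> appear.\<close>
  let ?S = "\<Sum>j\<le>M. \<Sum>\<^sub>\<infinity>ks\<in>Delta (Suc j). g (Suc j) ks * chaos_coeff F ks"
  have uL: "(\<lambda>(\<omega>, k). u k \<omega>) \<in> L2 (Omega p \<Otimes>\<^sub>M count_space UNIV)"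
    and g: "\<And>j. j \<in> {..M} \<Longrightarrow> g (Suc j) \<in> l2 (Suc j)"
    and AE: "\<And>k. AE \<omega> in Omega p. u k \<omega> = (\<Sum>j\<le>M. J p j (slice (g (Suc j)) k) \<omega>)"
    using u by (auto simp: process_expansion_def l2_sym_tensor_def)
  have FL: "F \<in> L2 (Omega p)" using F by (simp add: chaos_expansion_def)
  note u_L2 = L2_pair_count_space[OF prob_space_Omega uL]
  have inner: "(\<integral>\<omega>. gradient_of N f k \<omega> * u k \<omega> \<partial>Omega p) =
      (\<Sum>j\<le>M. \<integral>\<omega>. J p j (slice (g (Suc j)) k) \<omega> * gradient_of N f k \<omega> \<partial>Omega p)" for k
  proof -
    have "(\<integral>\<omega>. gradient_of N f k \<omega> * u k \<omega> \<partial>Omega p) =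
        (\<integral>\<omega>. gradient_of N f k \<omega> * (\<Sum>j\<le>M. J p j (slice (g (Suc j)) k) \<omega>) \<partial>Omega p)"
    proof (rule integral_cong_AE)
      show "AE \<omega> in Omega p. gradient_of N f k \<omega> * u k \<omega> =
          gradient_of N f k \<omega> * (\<Sum>j\<le>M. J p j (slice (g (Suc j)) k) \<omega>)"
        using AE[of k] by eventually_elim simp
    qed (intro borel_measurable_times L2_borel_measurable gradient_of_L2[OF F] u_L2 L2_sum J_L2_limit
        l2_slice g, assumption?)+
    also have "\<dots> = (\<Sum>j\<le>M. \<integral>\<omega>. J p j (slice (g (Suc j)) k) \<omega> * gradient_of N f k \<omega> \<partial>Omega p)"
      using inner_sum_J[where I = "{..M}" and f = "\<lambda>j. slice (g (Suc j)) k" and d = "\<lambda>j. j"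
          and a = "\<lambda>_. 1" and G = "gradient_of N f k", OF l2_slice[OF g] gradient_of_L2[OF F]]
      by simp
    finally show ?thesis .
  qed
  \<comment> \<open>The gradient side: the exchange is justified by the summable squared norms of
    the gradient and of \<open>u\<close>.\<close>
  have "(\<integral>\<omega>. (\<Sum>\<^sub>\<infinity>k. gradient_of N f k \<omega> * u k \<omega>) \<partial>Omega p) =
      (\<Sum>\<^sub>\<infinity>k. \<integral>\<omega>. gradient_of N f k \<omega> * u k \<omega> \<partial>Omega p)"
    by (rule integral_infsum_inner[OF gradient_of_L2[OF F] u_L2(1)
          summable_gradient_of_square[OF F] u_L2(2)])
  also have "\<dots> = ?S"
    unfolding inner by (intro infsumI has_sum_sum has_sum_inner_gradient_of[OF F] g)
  \<comment> \<open>The divergence side: the coefficients of \<open>F\<close> depend only on the set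
    of entries, so each kernel may be symmetrized.\<close>
  also have "?S = (\<Sum>j\<le>M. \<integral>\<omega>. J p (Suc j) (symmetrize (Suc j) (g (Suc j))) \<omega> * F \<omega> \<partial>Omega p)"
  proof (intro sum.cong refl)
    fix j assume j: "j \<in> {..M}"
    have "((\<lambda>ks. g (Suc j) ks * chaos_coeff F ks) has_sum
        (\<Sum>\<^sub>\<infinity>ks\<in>Delta (Suc j). g (Suc j) ks * chaos_coeff F ks)) (Delta (Suc j))"
      by (intro has_sum_infsum summable_on_mult_of_squares l2_summable_Delta g j
          chaos_coeff_square_summable[OF F])
    then have "((\<lambda>ks. symmetrize (Suc j) (g (Suc j)) ks * chaos_coeff F ks) has_sum
        (\<Sum>\<^sub>\<infinity>ks\<in>Delta (Suc j). g (Suc j) ks * chaos_coeff F ks)) (Delta (Suc j))"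
      by (rule has_sum_symmetrize) (auto intro: chaos_coeff_cong)
    moreover have "((\<lambda>ks. symmetrize (Suc j) (g (Suc j)) ks * chaos_coeff F ks) has_sum
        (\<integral>\<omega>. J p (Suc j) (symmetrize (Suc j) (g (Suc j))) \<omega> * F \<omega> \<partial>Omega p)) (Delta (Suc j))"
      unfolding chaos_coeff_def by (intro J_inner_has_sum l2_symmetrize g j FL)
    ultimately show "(\<Sum>\<^sub>\<infinity>ks\<in>Delta (Suc j). g (Suc j) ks * chaos_coeff F ks) =
        (\<integral>\<omega>. J p (Suc j) (symmetrize (Suc j) (g (Suc j))) \<omega> * F \<omega> \<partial>Omega p)"
      by (rule has_sum_unique)
  qed
  also have "\<dots> = (\<integral>\<omega>. F \<omega> * divergence_of M g \<omega> \<partial>Omega p)"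
    using inner_sum_J[where I = "{..M}" and f = "\<lambda>j. symmetrize (Suc j) (g (Suc j))" and d = Suc
        and a = "\<lambda>_. 1" and G = F, OF l2_symmetrize[OF g] FL]
    by (simp add: divergence_of_def)
  finally show ?thesis .
qed

end

theorem proposition9p2:
  fixes p :: "nat \<Rightarrow> real"
    and F :: "(nat \<Rightarrow> real) \<Rightarrow> real"
    and u :: "nat \<Rightarrow> (nat \<Rightarrow> real) \<Rightarrow> real"
  assumes "\<And>k. 0 < p k \<and> p k < 1"
    and "F \<in> S_space p"
    and "u \<in> U_space p"
  shows "(\<integral>\<omega>. (\<Sum>\<^sub>\<infinity>k. gradient p F k \<omega> * u k \<omega>) \<partial>Omega p)
       = (\<integral>\<omega>. F \<omega> * divergence p u \<omega> \<partial>Omega p)"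
proof -
  interpret coin_sequence p by unfold_locales (rule assms(1))
  let ?G = "\<lambda>G. \<exists>N f. chaos_expansion p F N f \<and> G = (\<lambda>k \<omega>. \<Sum>j=1..N. real j *
      J p (j - 1) (slice (\<lambda>ks. f j ks * indicator (Delta j) ks) k) \<omega>)"
  let ?D = "\<lambda>G. \<exists>M g. process_expansion p u M g \<and>
      G = (\<lambda>\<omega>. \<Sum>j\<le>M. J p (Suc j) (symmetrize (Suc j) (g (Suc j))) \<omega>)"
  \<comment> \<open>Membership in the two spaces supplies an expansion, so the values chosen by
    \<open>SOME\<close> do come from expansions of \<open>F\<close> and \<open>u\<close>.\<close>
  have "\<exists>G. ?G G" using assms(2) by (auto simp: S_space_def)
  then have "?G (gradient p F)" unfolding gradient_def by (rule someI_ex)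
  then obtain N f where F: "chaos_expansion p F N f" and gradient: "gradient p F = gradient_of N f"
    by (auto simp: gradient_of_def fun_eq_iff)
  have "\<exists>G. ?D G" using assms(3) by (auto simp: U_space_def)
  then have "?D (divergence p u)" unfolding divergence_def by (rule someI_ex)
  then obtain M g where u: "process_expansion p u M g" and divergence: "divergence p u = divergence_of M g"
    by (auto simp: divergence_of_def fun_eq_iff)
  show ?thesis
    unfolding gradient divergence by (rule duality_expansions[OF F u])
qed

end
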